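(* Let $P$ satisfy (F1), (F2), (F3) and let $J>0$. If the topology on $R(\mathbb{R}^3)$ is inherited from a topological vector space, then there is no local minimizer $\rho$ of $E_J$ restricted to $R(\mathbb{R}^3)$ with $E_J(\rho)<\infty$.
   Context: Assumptions on the pressure: (F1) $P:[0,\infty)\to[0,\infty)$ is continuous and strictly increasing; (F2) $\lim_{s\to0^+}P(s)s^{-4/3}=0$; (F3) $\lim_{s\to\infty}P(s)s^{-4/3}=\infty$. Define $A(s)=s\int_0^sP(\tau)\tau^{-2}\,d\tau$ for $s>0$, $A(0)=0$. $R(\mathbb{R}^3)=\{\rho\in L^{4/3}(\mathbb{R}^3):\rho\ge0,\ \int\rho\,dx=1\}$. $U(\rho)=\int A(\rho)\,dx$, $V_\rho(x)=\int\frac{\rho(y)}{|x-y|}\,dy$, $G(\rho,\rho)=\int V_\rho\rho\,dx$ (finite on $R(\mathbb{R}^3)$), $r(x)=\sqrt{x_1^2+x_2^2}$, $\bar x(\rho)=\int x\rho\,dx/\int\rho\,dx$, $I(\rho)=\int\rho(x)r^2(x-\bar x(\rho))\,dx$ (only the first two components of $\bar x(\rho)$ matter; convention: $I(\rho)=\infty$ and $J^2/(2I(\rho))=0$ if $\int r^2\rho\,dx=\infty$), and $E_J(\rho)=U(\rho)-\frac12G(\rho,\rho)+\frac{J^2}{2I(\rho)}\in(-\infty,\infty]$. "The topology on $R(\mathbb{R}^3)$ is inherited from a topological vector space" means: there is a real topological vector space $Y$ containing $R(\mathbb{R}^3)$, whose vector space operations agree with the usual ones for functions on the linear span of $R(\mathbb{R}^3)$,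 and $R(\mathbb{R}^3)$ carries the subspace topology. A local minimizer of $E_J$ restricted to $R(\mathbb{R}^3)$ is a $\rho\in R(\mathbb{R}^3)$ having a neighbourhood $O$ in $R(\mathbb{R}^3)$ with $E_J(\rho)\le E_J(\kappa)$ for all $\kappa\in O$. *)

theory Defs
  imports "HOL-Analysis.Analysis"
begin

section \<open>The pressure and the internal energy density\<close>

definition pressure :: "(real \<Rightarrow> real) \<Rightarrow> bool" where
  "pressure P \<longleftrightarrow> (\<forall>s\<ge>0. P s \<ge> 0) \<and> continuous_on {0..} P \<and> strict_mono_on {0..} P"

definition small_density_condition :: "(real \<Rightarrow> real) \<Rightarrow> bool" where
  "small_density_condition P \<longleftrightarrow> ((\<lambda>s. P s * s powr (- 4/3)) \<longlongrightarrow> 0) (at_right 0)"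

definition large_density_condition :: "(real \<Rightarrow> real) \<Rightarrow> bool" where
  "large_density_condition P \<longleftrightarrow> filterlim (\<lambda>s. P s * s powr (- 4/3)) at_top at_top"

(* The integrand is integrable near 0 by the small-density condition; A(0) = 0 holds
   because the interval is empty. *)
definition internal_density :: "(real \<Rightarrow> real) \<Rightarrow> real \<Rightarrow> real" where
  "internal_density P s = s * (LINT \<tau>:{0<..<s}|lborel. P \<tau> / \<tau>\<^sup>2)"

section \<open>Densities and the energy functional\<close>

(* Elements of R(R^3) are almost-everywhere classes. They are represented here by Borel
   functions; a.e. equal functions are identified by the inclusion into the topological
   vector space, see inclusion_into_tvs below. *)
definition densities :: "(real^3 \<Rightarrow> real) set" where
  "densities = {\<rho>. \<rho> \<in> borel_measurable lborel
                 \<and> integrable lborel (\<lambda>x. \<bar>\<rho> x\<bar> powr (4/3))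
                 \<and> (AE x in lborel. 0 \<le> \<rho> x)
                 \<and> integrable lborel \<rho> \<and> (LINT x|lborel. \<rho> x) = 1}"

definition internal_energy :: "(real \<Rightarrow> real) \<Rightarrow> (real^3 \<Rightarrow> real) \<Rightarrow> ennreal" where
  "internal_energy P \<rho> = (\<integral>\<^sup>+x. ennreal (internal_density P (\<rho> x)) \<partial>lborel)"

definition potential :: "(real^3 \<Rightarrow> real) \<Rightarrow> real^3 \<Rightarrow> ennreal" where
  "potential \<rho> x = (\<integral>\<^sup>+y. ennreal (\<rho> y / norm (x - y)) \<partial>lborel)"

definition gravity :: "(real^3 \<Rightarrow> real) \<Rightarrow> ennreal" where
  "gravity \<rho> = (\<integral>\<^sup>+x. potential \<rho> x * ennreal (\<rho> x) \<partial>lborel)"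

definition axis_dist :: "real^3 \<Rightarrow> real" where
  "axis_dist x = sqrt ((x$1)\<^sup>2 + (x$2)\<^sup>2)"

(* Componentwise, because the third first moment may diverge even if the first two are
   finite, and the Bochner integral of a non-integrable vector function is 0. The third
   component does not affect the moment of inertia. *)
definition center_of_mass :: "(real^3 \<Rightarrow> real) \<Rightarrow> real^3" where
  "center_of_mass \<rho> = (\<chi> i. (LINT x|lborel. x$i * \<rho> x) / (LINT x|lborel. \<rho> x))"

definition moment_of_inertia :: "(real^3 \<Rightarrow> real) \<Rightarrow> ennreal" where
  "moment_of_inertia \<rho> =
     (if (\<integral>\<^sup>+x. ennreal ((axis_dist x)\<^sup>2 * \<rho> x) \<partial>lborel) = \<infinity> then \<infinity>
      else (\<integral>\<^sup>+x. ennreal (\<rho> x * (axis_dist (x - center_of_mass \<rho>))\<^sup>2) \<partial>lborel))"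

(* For a density the gravitational term is finite and the moment of inertia is positive,
   so the only degenerate operation is division by an infinite moment of inertia, which
   gives 0 in ereal. *)
definition energy :: "(real \<Rightarrow> real) \<Rightarrow> real \<Rightarrow> (real^3 \<Rightarrow> real) \<Rightarrow> ereal" where
  "energy P J \<rho> = enn2ereal (internal_energy P \<rho>) - enn2ereal (gravity \<rho>) / 2
                   + ereal (J\<^sup>2) / (2 * enn2ereal (moment_of_inertia \<rho>))"

section \<open>Topologies inherited from a topological vector space\<close>

(* No separation axiom is required. The carrier may be any linear subspace of the type. *)
definition topological_vector_space :: "'v::real_vector topology \<Rightarrow> bool" where
  "topological_vector_space Y \<longleftrightarrow>
     subspace (topspace Y) \<and>
     continuous_map (prod_topology Y Y) Y (\<lambda>(u, v). u + v) \<and>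
     continuous_map (prod_topology euclideanreal Y) Y (\<lambda>(c, v). c *\<^sub>R v)"

definition function_span :: "('a \<Rightarrow> real) set \<Rightarrow> ('a \<Rightarrow> real) set" where
  "function_span S = {(\<lambda>x. \<Sum>f\<in>F. c f * f x) | F c. finite F \<and> F \<subseteq> S}"

(* The vector space Y contains the classes of the functions in S, and its operations agree
   with the pointwise ones on their linear span; j sends a function to its class in Y. *)
definition inclusion_into_tvs ::
  "(real^3 \<Rightarrow> real) set \<Rightarrow> ((real^3 \<Rightarrow> real) \<Rightarrow> 'v::real_vector) \<Rightarrow> 'v topology \<Rightarrow> bool" where
  "inclusion_into_tvs S j Y \<longleftrightarrow>
     topological_vector_space Y \<and>
     (\<forall>f\<in>function_span S. j f \<in> topspace Y) \<and>
     (\<forall>f\<in>function_span S. \<forall>g\<in>function_span S. j f = j g \<longleftrightarrow> (AE x in lborel. f x = g x)) \<and>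
     (\<forall>f\<in>function_span S. \<forall>g\<in>function_span S. j (\<lambda>x. f x + g x) = j f + j g) \<and>
     (\<forall>f\<in>function_span S. \<forall>c. j (\<lambda>x. c * f x) = c *\<^sub>R j f)"

definition local_minimizer :: "'a topology \<Rightarrow> ('a \<Rightarrow> ereal) \<Rightarrow> 'a \<Rightarrow> bool" where
  "local_minimizer T E \<rho> \<longleftrightarrow>
     \<rho> \<in> topspace T \<and>
     (\<exists>N W. N \<subseteq> topspace T \<and> openin T W \<and> \<rho> \<in> W \<and> W \<subseteq> N \<and> (\<forall>\<kappa>\<in>N. E \<rho> \<le> E \<kappa>))"

end

theory Submission
  imports Defs
begin

text \<open>A vector space topology contains every segment \<open>(1 - t) \<rho> + t \<sigma>\<close> as a continuous curve, so a
  local minimizer is minimal along all segments for small \<open>t\<close>.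

  If \<open>\<rho>\<close> has finite second moment, let \<open>\<sigma>\<close> have infinite second moment: the rotational energy
  drops to 0 for every \<open>t > 0\<close>, while the other terms change by \<open>O(t)\<close>.

  If \<open>\<rho>\<close> has infinite second moment, the rotational energy plays no role along segments. By (F2) mass
  can be deposited on some set with a net gain \<open>\<epsilon>\<close> per unit, so removing a fraction \<open>v\<close> of \<open>\<rho>\<close> must not
  pay: \<open>\<integral> v A(\<rho>) + \<epsilon> \<integral> v \<rho> \<le> \<integral> v \<rho> V\<close>. By homogeneity \<open>v\<close> may be a truncation of \<open>(1 + |x|)\<^sup>2\<close>; then the
  right-hand side is, by (F3) and the smallness of the mass far out, at most
  \<open>\<integral> v A(\<rho>) + (\<epsilon>/2) \<integral> v \<rho>\<close> plus a term independent of the truncation; hence the second moment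
  is finite after all.\<close>

section \<open>Internal energy density\<close>

text \<open>The exponent 4/3 is critical for Newtonian gravity in three dimensions. Matter of
  density at most s and mass m has a potential of order at most m^(2/3) s^(1/3), and s^(1/3) is also
  the size of A(s)/s when P(s) is of order s^(4/3). Hence (F2) makes thinly spread matter cheaper
  than the potential it is placed in, and (F3) lets the internal energy dominate the near part of
  the potential wherever little mass is around. The obstacle in the second case is that the
  potential at a point is not controlled by the density there if denser matter lies nearby. In a
  weighted integral of rho V the interaction must then be charged to the other point of the pair,
  where the weight is different. A polynomial weight survives this: within distance L the function
  (1 + |x|)^2 changes at most by the factor (1 + L)^2, and truncation keeps this property. Matter
  beyond distance L adds at most 1/L to the potential, so a large L makes its share a small part of
  the gain.\<close>

definition specific_energy :: "(real \<Rightarrow> real) \<Rightarrow> real \<Rightarrow> real" where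
  "specific_energy P s = (LINT \<tau>:{0<..<s}|lborel. P \<tau> / \<tau>\<^sup>2)"

lemma internal_density_eq: "internal_density P s = s * specific_energy P s"
  by (simp add: internal_density_def specific_energy_def)

lemma specific_energy_nonpos [simp]: "s \<le> 0 \<Longrightarrow> specific_energy P s = 0"
  by (simp add: specific_energy_def set_lebesgue_integral_def)

lemma pressure_nonneg: "pressure P \<Longrightarrow> 0 \<le> s \<Longrightarrow> 0 \<le> P s"
  by (simp add: pressure_def)

lemma pressure_mono: "pressure P \<Longrightarrow> 0 \<le> s \<Longrightarrow> s \<le> u \<Longrightarrow> P s \<le> P u"
  unfolding pressure_def using strict_mono_on_leD[of "{0..}" P s u] by auto

lemma small_density_bound:
  assumes "small_density_condition P" and "\<eta> > 0"
  obtains s0 where "s0 > 0" "\<And>s. 0 < s \<Longrightarrow> s \<le> s0 \<Longrightarrow> P s \<le> \<eta> * s powr (4/3)"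
proof -
  have "eventually (\<lambda>s. P s * s powr (-4/3) < \<eta>) (at_right 0)"
    using assms unfolding small_density_condition_def by (auto simp: order_tendsto_iff)
  then obtain b where b: "b > 0" "\<And>y. y > 0 \<Longrightarrow> y < b \<Longrightarrow> P y * y powr (-4/3) < \<eta>"
    unfolding eventually_at_right_field by auto
  show ?thesis
  proof
    show "b / 2 > 0" using b by simp
    fix s assume s: "0 < s" "s \<le> b / 2"
    then have "P s * s powr (-4/3) < \<eta>" using b by simp
    then have "P s * s powr (-4/3) * s powr (4/3) \<le> \<eta> * s powr (4/3)"
      by (intro mult_right_mono) auto
    then show "P s \<le> \<eta> * s powr (4/3)"
      using s by (simp add: mult.assoc flip: powr_add)
  qed
qed

lemma large_density_bound:
  assumes "large_density_condition P"
  obtains S where "S > 0" "\<And>s. S \<le> s \<Longrightarrow> s powr (4/3) \<le> P s"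
proof -
  have "eventually (\<lambda>s. 1 \<le> P s * s powr (-4/3)) at_top"
    using assms unfolding large_density_condition_def by (auto simp: filterlim_at_top)
  then obtain b where b: "\<And>s. s \<ge> b \<Longrightarrow> 1 \<le> P s * s powr (-4/3)"
    unfolding eventually_at_top_linorder by auto
  show ?thesis
  proof
    show "max b 1 > 0" by simp
    fix s assume s: "max b 1 \<le> s"
    then have "1 * s powr (4/3) \<le> P s * s powr (-4/3) * s powr (4/3)"
      using b by (intro mult_right_mono) auto
    then show "s powr (4/3) \<le> P s"
      using s by (simp add: mult.assoc flip: powr_add)
  qed
qed

lemma powr_div_square:
  fixes x :: real
  assumes "x > 0"
  shows "x powr (4/3) / x\<^sup>2 = x powr (-2/3)"
proof -
  have "x powr (4/3) / x powr 2 = x powr (4/3 - 2)" by (rule powr_diff[symmetric])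
  then show ?thesis using assms by simp
qed

lemma integrable_powr_0:
  fixes s :: real
  assumes "s \<ge> 0"
  shows "set_integrable lborel {0<..<s} (\<lambda>\<tau>. \<tau> powr (-2/3))"
    and "(LINT \<tau>:{0<..<s}|lborel. \<tau> powr (-2/3)) = 3 * s powr (1/3)"
proof -
  have hi: "((\<lambda>\<tau>. \<tau> powr (-2/3)) has_integral (s powr (1/3) / (1/3))) {0..s}"
    using has_integral_powr_from_0[of "-2/3" s] assms by simp
  have hi': "((\<lambda>\<tau>. \<tau> powr (-2/3)) has_integral (s powr (1/3) / (1/3))) {0<..<s}"
    using hi by (simp add: has_integral_Icc_iff_Ioo)
  have "(\<lambda>\<tau>. \<tau> powr (-2/3)) absolutely_integrable_on {0<..<s}"
    using hi' by (intro nonnegative_absolutely_integrable_1) auto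
  then show i: "set_integrable lborel {0<..<s} (\<lambda>\<tau>. \<tau> powr (-2/3))"
    unfolding set_integrable_def by (subst (asm) integrable_completion) auto
  show "(LINT \<tau>:{0<..<s}|lborel. \<tau> powr (-2/3)) = 3 * s powr (1/3)"
    using set_borel_integral_eq_integral(2)[OF i] integral_unique[OF hi'] by simp
qed

lemma borel_measurable_specific_integrand:
  assumes "pressure P"
  shows "set_borel_measurable borel {0<..<s} (\<lambda>\<tau>. P \<tau> / \<tau>\<^sup>2)"
  unfolding set_borel_measurable_def
  using assms unfolding pressure_def
  by (intro borel_measurable_continuous_on_indicator continuous_intros)
     (auto intro: continuous_on_subset)

text \<open>The singularity at 0 is integrable because (F2) bounds the integrand by tau^(-2/3) up to
  \<open>s0\<close>; beyond \<open>s0\<close> monotonicity of P bounds it by a constant. The sum of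
  the two bounds is one majorant for both ranges.\<close>

lemma specific_integrand_integrable:
  assumes P: "pressure P" and F2: "small_density_condition P"
  shows "set_integrable lborel {0<..<s} (\<lambda>\<tau>. P \<tau> / \<tau>\<^sup>2)"
proof (cases "s > 0")
  case True
  obtain s0 where s0: "s0 > 0" "\<And>s. 0 < s \<Longrightarrow> s \<le> s0 \<Longrightarrow> P s \<le> 1 * s powr (4/3)"
    by (rule small_density_bound[OF F2, of 1]) auto
  show ?thesis
  proof (rule set_integrable_bound)
    show "set_integrable lborel {0<..<s} (\<lambda>\<tau>. \<tau> powr (-2/3) + P s / s0\<^sup>2)"
      using integrable_powr_0[of s] True
      by (intro set_integral_add) (auto simp: set_integrable_def)
    show "set_borel_measurable lborel {0<..<s} (\<lambda>\<tau>. P \<tau> / \<tau>\<^sup>2)"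
      using borel_measurable_specific_integrand[OF P, of s]
      by (simp add: set_borel_measurable_def)
    show "AE x in lborel. x \<in> {0<..<s} \<longrightarrow>
      norm (P x / x\<^sup>2) \<le> norm (x powr (-2/3) + P s / s0\<^sup>2)"
    proof (intro always_eventually allI impI)
      fix x assume x: "x \<in> {0<..<s}"
      have Px: "0 \<le> P x" "P x \<le> P s" "0 \<le> P s"
        using x P by (auto intro: pressure_nonneg pressure_mono)
      have "P x / x\<^sup>2 \<le> x powr (-2/3) + P s / s0\<^sup>2"
      proof (cases "x \<le> s0")
        case True
        have "P x \<le> x powr (4/3)" using s0(2)[of x] x True by simp
        then have "P x / x\<^sup>2 \<le> x powr (4/3) / x\<^sup>2"
          by (simp add: divide_right_mono)
        also have "\<dots> = x powr (-2/3)" using x by (intro powr_div_square) simp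
        finally show ?thesis using Px by (simp add: add_increasing2)
      next
        case False
        then have "P x / x\<^sup>2 \<le> P s / s0\<^sup>2"
          using Px s0 by (intro frac_le power_mono) auto
        then show ?thesis by (simp add: add_increasing)
      qed
      then show "norm (P x / x\<^sup>2) \<le> norm (x powr (-2/3) + P s / s0\<^sup>2)"
        using Px by simp
    qed
  qed
qed (simp add: set_integrable_def)

lemma specific_energy_integral:
  assumes "pressure P" "small_density_condition P"
  shows "(\<lambda>\<tau>. P \<tau> / \<tau>\<^sup>2) integrable_on {0..s}"
    and "specific_energy P s = integral {0..s} (\<lambda>\<tau>. P \<tau> / \<tau>\<^sup>2)"
  using set_borel_integral_eq_integral[OF specific_integrand_integrable[OF assms, of s]]
  by (auto simp: specific_energy_def integrable_on_Icc_iff_Ioo integral_open_interval_real)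

lemma has_integral_inverse_square:
  fixes s u :: real
  assumes "0 < s" "s \<le> u"
  shows "((\<lambda>\<tau>. c / \<tau>\<^sup>2) has_integral c * (1/s - 1/u)) {s..u}"
proof -
  have "((\<lambda>\<tau>. c / \<tau>\<^sup>2) has_integral (- c / u - (- c / s))) {s..u}"
    using assms
    by (intro fundamental_theorem_of_calculus)
       (auto intro!: derivative_eq_intros
             simp: power2_eq_square simp flip: has_real_derivative_iff_has_vector_derivative)
  then show ?thesis by (simp add: algebra_simps)
qed

text \<open>The increment is the integral of P(tau)/tau^2 over [s, u]; monotonicity squeezes P
  between its end values, and tau^(-2) integrates to 1/s - 1/u. The two bounds take the place of the
  derivative of A(s)/s.\<close>

lemma specific_energy_increment:
  assumes P: "pressure P" "small_density_condition P" and su: "0 < s" "s \<le> u"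
  shows "P s * (1/s - 1/u) \<le> specific_energy P u - specific_energy P s"
    and "specific_energy P u - specific_energy P s \<le> P u * (1/s - 1/u)"
proof -
  let ?f = "\<lambda>\<tau>. P \<tau> / \<tau>\<^sup>2"
  have "integral {0..s} ?f + integral {s..u} ?f = integral {0..u} ?f"
    using su by (intro Henstock_Kurzweil_Integration.integral_combine
        specific_energy_integral(1)[OF P]) auto
  then have eq: "specific_energy P u - specific_energy P s = integral {s..u} ?f"
    by (simp add: specific_energy_integral(2)[OF P])
  have int: "?f integrable_on {s..u}"
    using integrable_subinterval_real[OF specific_energy_integral(1)[OF P, of u]] su by auto
  have "P s * (1/s - 1/u) \<le> integral {s..u} ?f"
    using has_integral_inverse_square[OF su, of "P s"] int su pressure_mono[OF P(1)]
    by (intro has_integral_le[OF has_integral_inverse_square[OF su]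
          integrable_integral[OF int]]) (auto intro!: divide_right_mono)
  then show "P s * (1/s - 1/u) \<le> specific_energy P u - specific_energy P s"
    by (simp add: eq)
  have "integral {s..u} ?f \<le> P u * (1/s - 1/u)"
    using su pressure_mono[OF P(1)]
    by (intro has_integral_le[OF integrable_integral[OF int]
          has_integral_inverse_square[OF su]]) (auto intro!: divide_right_mono)
  then show "specific_energy P u - specific_energy P s \<le> P u * (1/s - 1/u)"
    by (simp add: eq)
qed

lemma specific_energy_nonneg:
  assumes "pressure P"
  shows "0 \<le> specific_energy P s"
  unfolding specific_energy_def set_lebesgue_integral_def
  by (rule integral_nonneg_AE)
     (use pressure_nonneg[OF assms] in \<open>auto intro!: always_eventually simp: indicator_def\<close>)

text \<open>The main structural property of A(s)/s: it makes A Borel measurable, bounds the internal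
  energy of a bounded density by its mass, and yields
  \<open>internal_density_shrink\<close>.\<close>

lemma mono_specific_energy:
  assumes P: "pressure P" "small_density_condition P"
  shows "mono (specific_energy P)"
proof (rule monoI)
  fix s u :: real assume su: "s \<le> u"
  show "specific_energy P s \<le> specific_energy P u"
  proof (cases "s > 0")
    case True
    then have "0 \<le> P s * (1/s - 1/u)"
      using su True pressure_nonneg[OF P(1), of s]
      by (intro mult_nonneg_nonneg) (auto intro: divide_left_mono)
    then show ?thesis using specific_energy_increment(1)[OF P True su] by linarith
  qed (simp add: specific_energy_nonneg[OF P(1)])
qed

lemma internal_density_nonneg:
  assumes "pressure P"
  shows "0 \<le> internal_density P s"
  by (cases "s \<ge> 0") (auto simp: internal_density_eq specific_energy_nonneg[OF assms])

lemma borel_measurable_internal_density [measurable]: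
  assumes "pressure P" "small_density_condition P"
  shows "internal_density P \<in> borel_measurable borel"
  unfolding internal_density_eq[abs_def]
  using borel_measurable_mono[OF mono_specific_energy[OF assms]] by measurable

text \<open>The slope is A'(s), obtained by differentiating s times A(s)/s. That the tangent stays
  below A reduces to the increment bounds: the lower one for u above s, the upper one for u below s,
  with u = 0 apart because of 1/u. Both convexity and the marginal cost of added matter come from
  here.\<close>

lemma internal_density_supporting_line:
  assumes P: "pressure P" "small_density_condition P" and su: "0 < s" "0 \<le> u"
  shows "internal_density P s + (u - s) * (specific_energy P s + P s / s) \<le> internal_density P u"
proof -
  have "(u - s) * (P s / s) \<le> u * (specific_energy P u - specific_energy P s)"
  proof (cases "s \<le> u")
    case True
    then have "u * (P s * (1/s - 1/u)) \<le> u * (specific_energy P u - specific_energy P s)"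
      using specific_energy_increment(1)[OF P su(1) True] su by (intro mult_left_mono) auto
    moreover have "u * (P s * (1/s - 1/u)) = (u - s) * (P s / s)"
      using su True by (simp add: field_simps)
    ultimately show ?thesis by simp
  next
    case False
    show ?thesis
    proof (cases "u = 0")
      case True
      then show ?thesis using su pressure_nonneg[OF P(1), of s] by simp
    next
      case u: False
      then have "u * (specific_energy P s - specific_energy P u) \<le> u * (P s * (1/u - 1/s))"
        using specific_energy_increment(2)[OF P, of u s] su False by (intro mult_left_mono) auto
      moreover have "u * (P s * (1/u - 1/s)) = (s - u) * (P s / s)"
        using su u by (simp add: field_simps)
      moreover have "(s - u) * (P s / s) = - ((u - s) * (P s / s))"
        "u * (specific_energy P s - specific_energy P u)
          = - (u * (specific_energy P u - specific_energy P s))" by (simp_all only: algebra_simps)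
      ultimately show ?thesis by linarith
    qed
  qed
  then show ?thesis by (simp add: internal_density_eq algebra_simps)
qed

text \<open>The supporting line at the intermediate point is compared with A at both ends; in the
  weighted sum the slope terms cancel. Supporting lines are available only at positive densities,
  hence the separate case of density 0.\<close>

lemma internal_density_convex:
  assumes P: "pressure P" "small_density_condition P"
    and "0 \<le> a" "0 \<le> b" "0 \<le> t" "t \<le> 1"
  shows "internal_density P ((1 - t) * a + t * b)
    \<le> (1 - t) * internal_density P a + t * internal_density P b"
proof -
  define s where "s = (1 - t) * a + t * b"
  define g where "g = specific_energy P s + P s / s"
  have "s \<ge> 0" unfolding s_def using assms by simp
  then consider "s = 0" | "s > 0" by linarith
  then show ?thesis
  proof cases
    case 1
    then have "internal_density P s = 0" by (simp add: internal_density_eq)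
    then show ?thesis unfolding s_def
      using assms by (simp add: internal_density_nonneg)
  next
    case 2
    have "(1 - t) * (internal_density P s + (a - s) * g) \<le> (1 - t) * internal_density P a"
      "t * (internal_density P s + (b - s) * g) \<le> t * internal_density P b"
      unfolding g_def
      by (intro mult_left_mono internal_density_supporting_line assms 2; use assms in simp)+
    then have "(1 - t) * (internal_density P s + (a - s) * g)
        + t * (internal_density P s + (b - s) * g)
      \<le> (1 - t) * internal_density P a + t * internal_density P b" by linarith
    moreover have "(1 - t) * (internal_density P s + (a - s) * g)
        + t * (internal_density P s + (b - s) * g) = internal_density P s"
      by (simp add: s_def algebra_simps)
    ultimately show ?thesis by (simp add: s_def)
  qed
qed

lemma internal_density_shrink:
  assumes P: "pressure P" "small_density_condition P" and "0 \<le> s" "0 \<le> \<tau>" "\<tau> \<le> 1"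
  shows "internal_density P ((1 - \<tau>) * s) \<le> (1 - \<tau>) * internal_density P s"
proof -
  have "specific_energy P ((1 - \<tau>) * s) \<le> specific_energy P s"
    by (rule monoD[OF mono_specific_energy[OF P]]) (use assms in \<open>simp add: mult_left_le_one_le\<close>)
  then show ?thesis using assms by (simp add: internal_density_eq mult_left_mono mult.assoc)
qed

text \<open>The supporting line at s + d, evaluated at s, bounds the increase by d times the slope
  at u = s + d. Of the factor 4, three parts come from integrating tau^(-2/3) and one from
  P(u)/u.\<close>

lemma internal_density_slope_bound:
  assumes P: "pressure P" "small_density_condition P"
    and bound: "\<And>\<tau>. 0 < \<tau> \<Longrightarrow> \<tau> \<le> b \<Longrightarrow> P \<tau> \<le> \<eta> * \<tau> powr (4/3)"
    and "0 \<le> \<eta>" "0 \<le> s" "0 \<le> d" "s + d \<le> b"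
  shows "internal_density P (s + d) \<le> internal_density P s + d * (4 * \<eta> * b powr (1/3))"
proof (cases "s + d = 0")
  case False
  define u where "u = s + d"
  have u: "u > 0" "u \<le> b" using False assms by (auto simp: u_def)
  have "specific_energy P u \<le> (LINT \<tau>:{0<..<u}|lborel. \<eta> * \<tau> powr (-2/3))"
    unfolding specific_energy_def
  proof (rule set_integral_mono)
    show "set_integrable lborel {0<..<u} (\<lambda>\<tau>. \<eta> * \<tau> powr (-2/3))"
      using integrable_powr_0(1)[of u] u by auto
    fix \<tau> assume \<tau>: "\<tau> \<in> {0<..<u}"
    then have "P \<tau> / \<tau>\<^sup>2 \<le> \<eta> * (\<tau> powr (4/3) / \<tau>\<^sup>2)"
      using bound[of \<tau>] u by (simp add: divide_right_mono)
    also have "\<dots> = \<eta> * \<tau> powr (-2/3)" using \<tau> by (subst powr_div_square) auto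
    finally show "P \<tau> / \<tau>\<^sup>2 \<le> \<eta> * \<tau> powr (-2/3)" .
  qed (rule specific_integrand_integrable[OF P])
  also have "\<dots> = 3 * \<eta> * u powr (1/3)"
    using integrable_powr_0(2)[of u] u by simp
  finally have 1: "specific_energy P u \<le> 3 * \<eta> * u powr (1/3)" .
  have "P u / u \<le> \<eta> * u powr (4/3) / u powr 1"
    using bound[of u] u by (simp add: divide_right_mono)
  also have "\<dots> = \<eta> * u powr (1/3)" using u powr_diff[of u "4/3" 1] by simp
  finally have "specific_energy P u + P u / u \<le> 4 * \<eta> * u powr (1/3)" using 1 by simp
  also have "\<dots> \<le> 4 * \<eta> * b powr (1/3)"
    using u assms by (intro mult_left_mono powr_mono2) auto
  finally have "d * (specific_energy P u + P u / u) \<le> d * (4 * \<eta> * b powr (1/3))"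
    using assms by (intro mult_left_mono) auto
  moreover have "internal_density P u + (s - u) * (specific_energy P u + P u / u) \<le> internal_density P s"
    using assms u by (intro internal_density_supporting_line) auto
  ultimately show ?thesis by (simp add: u_def algebra_simps)
next
  case True
  then have "s = 0" "d = 0" using assms by auto
  then show ?thesis by simp
qed

text \<open>For large s the interval [s/2, s] alone contributes enough, since P is at least
  (s/2)^(4/3) there; this is the first entry of the minimum defining \<open>\<delta>\<close>. Below
  2 S the term \<open>\<epsilon>\<close> has to pay, which is the second entry.\<close>

lemma specific_energy_lower_bound:
  assumes P: "pressure P" "small_density_condition P" and F3: "large_density_condition P"
    and "\<epsilon> > 0"
  obtains \<delta> where "\<delta> > 0" "\<And>s. 0 \<le> s \<Longrightarrow> \<delta> * s powr (1/3) \<le> specific_energy P s + \<epsilon>"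
proof -
  obtain S where S: "S > 0" "\<And>s. S \<le> s \<Longrightarrow> s powr (4/3) \<le> P s"
    by (rule large_density_bound[OF F3]) auto
  define \<delta> where "\<delta> = min ((1/2) powr (4/3)) (\<epsilon> / (2 * S) powr (1/3))"
  have pos: "(2 * S) powr (1/3) > 0" using S by simp
  have "\<delta> > 0" using assms pos by (simp add: \<delta>_def)
  moreover have "\<delta> * s powr (1/3) \<le> specific_energy P s + \<epsilon>" if "0 \<le> s" for s
  proof (cases "2 * S \<le> s")
    case True
    have s: "s > 0" using True S by simp
    have "\<delta> * s powr (1/3) \<le> (1/2) powr (4/3) * s powr (1/3)"
      by (intro mult_right_mono) (auto simp: \<delta>_def)
    also have "\<dots> = (1/2) powr (4/3) * (s powr (4/3) / s)"
      using powr_diff[of s "4/3" 1] s by simp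
    also have "\<dots> = (s/2) powr (4/3) / s"
      using s powr_mult[of "1/2" s "4/3"] by simp
    also have "\<dots> \<le> P (s/2) / s" using S(2)[of "s/2"] True s by (simp add: divide_right_mono)
    also have "\<dots> = P (s/2) * (1/(s/2) - 1/s)" by simp
    also have "\<dots> \<le> specific_energy P s - specific_energy P (s/2)"
      using s by (intro specific_energy_increment P) auto
    also have "\<dots> \<le> specific_energy P s" using specific_energy_nonneg[OF P(1)] by simp
    finally show ?thesis using \<open>\<epsilon> > 0\<close> by simp
  next
    case False
    have "\<delta> * s powr (1/3) \<le> (\<epsilon> / (2 * S) powr (1/3)) * (2 * S) powr (1/3)"
      using False that \<open>\<delta> > 0\<close> by (intro mult_mono powr_mono2) (auto simp: \<delta>_def)
    then show ?thesis using specific_energy_nonneg[OF P(1), of s] pos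
      by (simp add: add_increasing)
  qed
  ultimately show ?thesis using that by blast
qed

section \<open>Bounds on the gravitational potential\<close>

text \<open>A dyadic decomposition in place of polar coordinates: between the radii l/2^(k+1) and
  l/2^k the kernel is at most 2 * 2^k / l. Multiplied by the ball volumes this gives a geometric
  series of ratio 1/4, and 8/3 is 2 times its sum 4/3. At y = x the quotient is 0 by the convention
  for division by zero.\<close>

lemma nn_integral_inverse_distance_ball:
  obtains C :: real where "C > 0"
    "\<And>(x::real^3) l. l > 0 \<Longrightarrow>
      (\<integral>\<^sup>+y. ennreal (if norm (x - y) < l then 1 / norm (x - y) else 0) \<partial>lborel) \<le> ennreal (C * l\<^sup>2)"
proof
  define \<kappa> where "\<kappa> = unit_ball_vol (real CARD(3))"
  have \<kappa>: "\<kappa> > 0" unfolding \<kappa>_def by simp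
  show "8/3 * \<kappa> > 0" using \<kappa> by simp
  fix x :: "real^3" and l :: real assume l: "l > 0"
  define a where "a k = 2 * 2^k / l" for k :: nat
  have [measurable]: "cball x r \<in> sets borel" for r by simp
  have "(\<integral>\<^sup>+y. ennreal (if norm (x - y) < l then 1 / norm (x - y) else 0) \<partial>lborel)
      \<le> (\<integral>\<^sup>+y. (\<Sum>k. ennreal (a k) * indicator (cball x (l/2^k)) y) \<partial>lborel)"
  proof (intro nn_integral_mono)
    fix y :: "real^3"
    show "ennreal (if norm (x - y) < l then 1 / norm (x - y) else 0)
        \<le> (\<Sum>k. ennreal (a k) * indicator (cball x (l/2^k)) y)"
    proof (cases "norm (x - y) < l \<and> x \<noteq> y")
      case True
      define d where "d = norm (x - y)"
      have d: "d > 0" "d < l" using True by (auto simp: d_def)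
      define k where "k = (LEAST k. l / 2^(Suc k) < d)"
      have "\<exists>k. (1/2)^k < d / l" using d by (intro real_arch_pow_inv) auto
      then obtain k0 where "(1/2)^k0 < d / l" by blast
      then have "l / 2^k0 < d" using d by (simp add: field_simps power_divide)
      moreover have "l / 2^Suc k0 \<le> l / 2^k0" using l by (simp add: field_simps)
      ultimately have ex: "\<exists>k. l / 2^(Suc k) < d" by (meson le_less_trans)
      have k1: "l / 2^(Suc k) < d" unfolding k_def using LeastI_ex[OF ex] .
      have k2: "d \<le> l / 2^k"
      proof (cases k)
        case (Suc k')
        then have "\<not> l / 2^(Suc k') < d"
          using not_less_Least[of k' "\<lambda>k. l / 2^(Suc k) < d"] unfolding k_def by simp
        then show ?thesis using Suc by simp
      qed (use d in simp)
      have "1 / d \<le> a k" unfolding a_def using k1 d l by (simp add: field_simps)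
      then have "ennreal (1 / d) \<le> ennreal (a k) * indicator (cball x (l/2^k)) y"
        using k2 by (auto simp: d_def dist_norm intro!: ennreal_leI)
      also have "\<dots> = (\<Sum>k\<in>{k}. ennreal (a k) * indicator (cball x (l/2^k)) y)"
        by (simp only: sum.insert finite.emptyI empty_iff not_False_eq_True sum.empty add_0_right)
      also have "\<dots> \<le> (\<Sum>k. ennreal (a k) * indicator (cball x (l/2^k)) y)"
        by (intro sum_le_suminf) auto
      finally show ?thesis using d by (simp add: d_def)
    qed auto
  qed
  also have "\<dots> = (\<Sum>k. \<integral>\<^sup>+y. ennreal (a k) * indicator (cball x (l/2^k)) y \<partial>lborel)"
    by (rule nn_integral_suminf) measurable
  also have "\<dots> = (\<Sum>k. ennreal (2 * \<kappa> * l\<^sup>2 * (1/4)^k))"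
  proof (intro suminf_cong)
    fix k
    have "(\<integral>\<^sup>+y. ennreal (a k) * indicator (cball x (l/2^k)) y \<partial>lborel)
        = ennreal (a k) * ennreal (\<kappa> * (l/2^k)^3)"
      using l by (simp add: nn_integral_cmult_indicator emeasure_cball \<kappa>_def)
    also have "\<dots> = ennreal (a k * (\<kappa> * (l/2^k)^3))"
      using l \<kappa> by (intro ennreal_mult[symmetric]) (auto simp: a_def)
    also have "a k * (\<kappa> * (l/2^k)^3) = 2 * \<kappa> * l\<^sup>2 * (1/4)^k"
    proof -
      have "(4::real)^k = 2^k * 2^k" by (simp flip: power_mult_distrib)
      then show ?thesis using l
        by (simp add: a_def field_simps power_divide power3_eq_cube power2_eq_square)
    qed
    finally show "(\<integral>\<^sup>+y. ennreal (a k) * indicator (cball x (l/2^k)) y \<partial>lborel)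
        = ennreal (2 * \<kappa> * l\<^sup>2 * (1/4)^k)" .
  qed
  also have "\<dots> = ennreal (8/3 * \<kappa> * l\<^sup>2)"
  proof -
    have "(\<lambda>k. 2 * \<kappa> * l\<^sup>2 * (1/4)^k) sums (2 * \<kappa> * l\<^sup>2 * (1 / (1 - 1/4)))"
      by (intro sums_mult geometric_sums) simp
    then have "(\<lambda>k. 2 * \<kappa> * l\<^sup>2 * (1/4)^k) sums (8/3 * \<kappa> * l\<^sup>2)" by (simp add: algebra_simps)
    then show ?thesis using \<kappa> by (subst suminf_ennreal_eq) auto
  qed
  finally show "(\<integral>\<^sup>+y. ennreal (if norm (x - y) < l then 1 / norm (x - y) else 0) \<partial>lborel)
      \<le> ennreal (8/3 * \<kappa> * l\<^sup>2)" .
qed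

text \<open>Beyond distance l the kernel is at most 1/l, so the mass bound gives m/l; within
  distance l the height bound gives C s l^2. The choice l^3 = m/s makes m/l and s l^2 equal.\<close>

lemma nn_integral_bounded_potential:
  obtains C :: real where "C > 0"
    "\<And>(g :: real^3 \<Rightarrow> real) s m x. \<lbrakk>g \<in> borel_measurable borel; \<And>y. 0 \<le> g y; \<And>y. g y \<le> s; 0 \<le> s; 0 < m;
       (\<integral>\<^sup>+y. ennreal (g y) \<partial>lborel) \<le> ennreal m\<rbrakk> \<Longrightarrow>
      (\<integral>\<^sup>+y. ennreal (g y / norm (x - y)) \<partial>lborel) \<le> ennreal (C * m powr (2/3) * s powr (1/3))"
proof -
  obtain C :: real where C: "C > 0" "\<And>(x::real^3) l. l > 0 \<Longrightarrow>
      (\<integral>\<^sup>+y. ennreal (if norm (x - y) < l then 1 / norm (x - y) else 0) \<partial>lborel) \<le> ennreal (C * l\<^sup>2)"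
    by (rule nn_integral_inverse_distance_ball) blast
  show ?thesis
  proof
    show "1 + C > 0" using C by simp
    fix g :: "real^3 \<Rightarrow> real" and s m :: real and x :: "real^3"
    assume g[measurable]: "g \<in> borel_measurable borel" and g0: "\<And>y. 0 \<le> g y"
      and gs: "\<And>y. g y \<le> s" and s: "0 \<le> s" and m: "0 < m"
      and mass: "(\<integral>\<^sup>+y. ennreal (g y) \<partial>lborel) \<le> ennreal m"
    show "(\<integral>\<^sup>+y. ennreal (g y / norm (x - y)) \<partial>lborel)
        \<le> ennreal ((1 + C) * m powr (2/3) * s powr (1/3))"
    proof (cases "s = 0")
      case True
      then have "g = (\<lambda>y. 0)" using g0 gs by (intro ext antisym) auto
      then show ?thesis by simp
    next
      case False
      then have s: "s > 0" using s by simp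
      define l where "l = (m / s) powr (1/3)"
      have l: "l > 0" using m s by (simp add: l_def)
      have "(\<integral>\<^sup>+y. ennreal (g y / norm (x - y)) \<partial>lborel)
         \<le> (\<integral>\<^sup>+y. ennreal (1/l) * ennreal (g y)
              + ennreal s * ennreal (if norm (x - y) < l then 1 / norm (x - y) else 0) \<partial>lborel)"
      proof (intro nn_integral_mono)
        fix y
        have "g y / norm (x - y) \<le> 1/l * g y + s * (if norm (x - y) < l then 1 / norm (x - y) else 0)"
        proof (cases "norm (x - y) < l")
          case True
          have "g y / norm (x - y) \<le> s / norm (x - y)"
            using gs by (intro divide_right_mono) auto
          then show ?thesis using True l g0[of y] by (simp add: add_increasing)
        next
          case False
          then have "g y / norm (x - y) \<le> g y / l"
            using l g0[of y] by (intro divide_left_mono mult_pos_pos) auto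
          then show ?thesis using False by simp
        qed
        then show "ennreal (g y / norm (x - y)) \<le> ennreal (1/l) * ennreal (g y)
              + ennreal s * ennreal (if norm (x - y) < l then 1 / norm (x - y) else 0)"
          using l g0[of y] s
          by (simp add: ennreal_leI flip: ennreal_mult ennreal_plus)
      qed
      also have "\<dots> = ennreal (1/l) * (\<integral>\<^sup>+y. ennreal (g y) \<partial>lborel)
          + ennreal s * (\<integral>\<^sup>+y. ennreal (if norm (x - y) < l then 1 / norm (x - y) else 0) \<partial>lborel)"
        by (subst nn_integral_add) (auto simp: nn_integral_cmult)
      also have "\<dots> \<le> ennreal (1/l) * ennreal m + ennreal s * ennreal (C * l\<^sup>2)"
        by (intro add_mono mult_left_mono mass C l) auto
      also have "\<dots> = ennreal (m / l + C * (s * l\<^sup>2))"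
        using l m s C(1) by (simp add: algebra_simps flip: ennreal_mult ennreal_plus)
      also have "m / l + C * (s * l\<^sup>2) = (1 + C) * m powr (2/3) * s powr (1/3)"
      proof -
        have "l\<^sup>2 = l powr 2" using l by simp
        also have "\<dots> = (m / s) powr (2/3)" unfolding l_def powr_powr by simp
        also have "\<dots> = m powr (2/3) / s powr (2/3)" using m s by (simp add: powr_divide)
        finally have "s * l\<^sup>2 = m powr (2/3) * (s powr 1 / s powr (2/3))" using s by simp
        also have "\<dots> = m powr (2/3) * s powr (1/3)" unfolding powr_diff[symmetric] by simp
        finally have 1: "s * l\<^sup>2 = m powr (2/3) * s powr (1/3)" .
        have "m / l = (m powr 1 / m powr (1/3)) * s powr (1/3)"
          using m s by (simp add: l_def powr_divide)
        also have "\<dots> = m powr (2/3) * s powr (1/3)" unfolding powr_diff[symmetric] by simp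
        finally show ?thesis using 1 by (simp add: algebra_simps)
      qed
      finally show ?thesis .
    qed
  qed
qed

text \<open>Only points at most as dense as x are counted, so that \<open>\<rho> x\<close> is a
  height bound for the matter involved, as \<open>nn_integral_bounded_potential\<close> requires.
  Denser neighbours admit no bound through \<open>\<rho> x\<close>; they are treated by symmetry of
  the kernel.\<close>

definition dominated_potential :: "(real^3 \<Rightarrow> real) \<Rightarrow> real \<Rightarrow> real^3 \<Rightarrow> ennreal" where
  "dominated_potential \<rho> L x =
     (\<integral>\<^sup>+y. ennreal (if norm (x - y) < L \<and> \<rho> y \<le> \<rho> x then \<rho> y / norm (x - y) else 0) \<partial>lborel)"

lemma borel_measurable_potential [measurable]:
  assumes [measurable]: "\<rho> \<in> borel_measurable borel"
  shows "potential \<rho> \<in> borel_measurable borel"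
  unfolding potential_def[abs_def] by measurable

lemma borel_measurable_dominated_potential [measurable]:
  assumes [measurable]: "\<rho> \<in> borel_measurable borel"
  shows "dominated_potential \<rho> L \<in> borel_measurable borel"
  unfolding dominated_potential_def[abs_def] by measurable

lemma dominated_potential_le:
  assumes "\<And>y. 0 \<le> \<rho> y"
  shows "dominated_potential \<rho> L x \<le> potential \<rho> x"
  unfolding dominated_potential_def potential_def
  using assms by (intro nn_integral_mono ennreal_leI) auto

lemma ennreal_add_bound:
  assumes "a \<le> b * c + d + e" "0 \<le> b" "0 \<le> c" "0 \<le> d" "0 \<le> e"
  shows "ennreal a \<le> ennreal b * ennreal c + ennreal d + ennreal e"
  using assms by (simp add: ennreal_leI flip: ennreal_mult ennreal_plus)

text \<open>Each unordered pair is charged to its point of higher density; comparability of the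
  weight makes this harmless.\<close>

lemma weighted_potential_bound:
  assumes [measurable]: "\<rho> \<in> borel_measurable borel" and \<rho>0: "\<And>x. 0 \<le> \<rho> x"
    and mass: "(\<integral>\<^sup>+y. ennreal (\<rho> y) \<partial>lborel) \<le> 1"
    and [measurable]: "w \<in> borel_measurable borel" and w0: "\<And>x. 0 \<le> w x"
    and w: "\<And>x y. norm (x - y) < L \<Longrightarrow> w y \<le> c * w x"
    and L: "L > 0" and c: "c \<ge> 0"
  shows "(\<integral>\<^sup>+x. ennreal (w x * \<rho> x) * potential \<rho> x \<partial>lborel)
    \<le> ennreal (1/L) * (\<integral>\<^sup>+x. ennreal (w x * \<rho> x) \<partial>lborel)
      + ennreal (1 + c) * (\<integral>\<^sup>+x. ennreal (w x * \<rho> x) * dominated_potential \<rho> L x \<partial>lborel)"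
proof -
  let ?d = "\<lambda>x y. if norm (x - y) < L \<and> \<rho> y \<le> \<rho> x then \<rho> y / norm (x - y) else 0"
  let ?e = "\<lambda>x y. if norm (x - y) < L \<and> \<rho> x \<le> \<rho> y then \<rho> y / norm (x - y) else 0"
  \<comment> \<open>Far points, near points at most as dense as x, and near points at least as dense
    as x. Equal densities are counted twice, which is harmless in an upper bound.\<close>
  have pot: "potential \<rho> x \<le> ennreal (1/L) + dominated_potential \<rho> L x
       + (\<integral>\<^sup>+y. ennreal (?e x y) \<partial>lborel)" for x
  proof -
    have "potential \<rho> x \<le> (\<integral>\<^sup>+y. ennreal (1/L) * ennreal (\<rho> y) + ennreal (?d x y) + ennreal (?e x y) \<partial>lborel)"
      unfolding potential_def
    proof (intro nn_integral_mono)
      fix y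
      have nn: "0 \<le> \<rho> y / norm (x - y)" using \<rho>0[of y] by simp
      have "\<rho> y / norm (x - y) \<le> 1/L * \<rho> y + ?d x y + ?e x y"
      proof (cases "norm (x - y) < L")
        case True
        then show ?thesis using \<rho>0[of y] L nn by (auto intro: add_increasing add_increasing2)
      next
        case False
        then have "\<rho> y / norm (x - y) \<le> \<rho> y / L"
          using L \<rho>0[of y] by (intro divide_left_mono mult_pos_pos) auto
        then show ?thesis using False by simp
      qed
      moreover have "0 \<le> ?d x y" "0 \<le> ?e x y" "0 \<le> 1/L * \<rho> y" using nn L \<rho>0[of y] by auto
      ultimately show "ennreal (\<rho> y / norm (x - y))
          \<le> ennreal (1/L) * ennreal (\<rho> y) + ennreal (?d x y) + ennreal (?e x y)"
        using L \<rho>0[of y] by (intro ennreal_add_bound) auto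
    qed
    also have "\<dots> = ennreal (1/L) * (\<integral>\<^sup>+y. ennreal (\<rho> y) \<partial>lborel) + dominated_potential \<rho> L x
       + (\<integral>\<^sup>+y. ennreal (?e x y) \<partial>lborel)"
      unfolding dominated_potential_def by (simp add: nn_integral_add nn_integral_cmult)
    also have "\<dots> \<le> ennreal (1/L) * 1 + dominated_potential \<rho> L x
       + (\<integral>\<^sup>+y. ennreal (?e x y) \<partial>lborel)"
      by (intro add_mono mult_left_mono mass) auto
    finally show ?thesis by simp
  qed
  \<comment> \<open>Exchanging the integrals makes the denser point y the outer variable; then
    \<open>w x\<close> is replaced by \<open>c * w y\<close>, and the inner integral is the
    dominated potential at y.\<close>
  have swap: "(\<integral>\<^sup>+x. ennreal (w x * \<rho> x) * (\<integral>\<^sup>+y. ennreal (?e x y) \<partial>lborel) \<partial>lborel)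
     \<le> ennreal c * (\<integral>\<^sup>+x. ennreal (w x * \<rho> x) * dominated_potential \<rho> L x \<partial>lborel)"
  proof -
    have "(\<integral>\<^sup>+x. ennreal (w x * \<rho> x) * (\<integral>\<^sup>+y. ennreal (?e x y) \<partial>lborel) \<partial>lborel)
      = (\<integral>\<^sup>+x. (\<integral>\<^sup>+y. ennreal (w x * \<rho> x) * ennreal (?e x y) \<partial>lborel) \<partial>lborel)"
      by (simp add: nn_integral_cmult)
    also have "\<dots> = (\<integral>\<^sup>+y. (\<integral>\<^sup>+x. ennreal (w x * \<rho> x) * ennreal (?e x y) \<partial>lborel) \<partial>lborel)"
      by (rule lborel_pair.Fubini') measurable
    also have "\<dots> \<le> (\<integral>\<^sup>+y. (\<integral>\<^sup>+x. ennreal c * (ennreal (w y * \<rho> y) * ennreal (?d y x)) \<partial>lborel) \<partial>lborel)"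
    proof (intro nn_integral_mono)
      fix y x
      have "w x * \<rho> x * ?e x y \<le> c * (w y * \<rho> y * ?d y x)"
      proof (cases "norm (x - y) < L \<and> \<rho> x \<le> \<rho> y")
        case True
        have "w x * (\<rho> x * \<rho> y / norm (x - y)) \<le> c * w y * (\<rho> x * \<rho> y / norm (x - y))"
          using True \<rho>0 by (intro mult_right_mono w) (auto simp: norm_minus_commute)
        then show ?thesis using True by (simp add: norm_minus_commute algebra_simps)
      qed (auto simp: norm_minus_commute)
      moreover have "0 \<le> ?e x y" "0 \<le> ?d y x" using \<rho>0 by auto
      ultimately show "ennreal (w x * \<rho> x) * ennreal (?e x y)
          \<le> ennreal c * (ennreal (w y * \<rho> y) * ennreal (?d y x))"
        using w0 \<rho>0 c by (simp only: ennreal_leI mult_nonneg_nonneg flip: ennreal_mult)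
    qed
    also have "\<dots> = ennreal c * (\<integral>\<^sup>+x. ennreal (w x * \<rho> x) * dominated_potential \<rho> L x \<partial>lborel)"
      unfolding dominated_potential_def by (simp add: nn_integral_cmult)
    finally show ?thesis .
  qed
  have "(\<integral>\<^sup>+x. ennreal (w x * \<rho> x) * potential \<rho> x \<partial>lborel)
    \<le> (\<integral>\<^sup>+x. ennreal (1/L) * ennreal (w x * \<rho> x) + ennreal (w x * \<rho> x) * dominated_potential \<rho> L x
       + ennreal (w x * \<rho> x) * (\<integral>\<^sup>+y. ennreal (?e x y) \<partial>lborel) \<partial>lborel)"
    using mult_left_mono[OF pot, of "ennreal (w _ * \<rho> _)"]
    by (intro nn_integral_mono) (simp add: distrib_left mult.commute)
  also have "\<dots> = ennreal (1/L) * (\<integral>\<^sup>+x. ennreal (w x * \<rho> x) \<partial>lborel)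
      + (\<integral>\<^sup>+x. ennreal (w x * \<rho> x) * dominated_potential \<rho> L x \<partial>lborel)
      + (\<integral>\<^sup>+x. ennreal (w x * \<rho> x) * (\<integral>\<^sup>+y. ennreal (?e x y) \<partial>lborel) \<partial>lborel)"
    by (simp add: nn_integral_add nn_integral_cmult)
  also have "\<dots> \<le> ennreal (1/L) * (\<integral>\<^sup>+x. ennreal (w x * \<rho> x) \<partial>lborel)
      + (\<integral>\<^sup>+x. ennreal (w x * \<rho> x) * dominated_potential \<rho> L x \<partial>lborel)
      + ennreal c * (\<integral>\<^sup>+x. ennreal (w x * \<rho> x) * dominated_potential \<rho> L x \<partial>lborel)"
    by (intro add_mono swap order_refl)
  also have "\<dots> = ennreal (1/L) * (\<integral>\<^sup>+x. ennreal (w x * \<rho> x) \<partial>lborel)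
      + ennreal (1 + c) * (\<integral>\<^sup>+x. ennreal (w x * \<rho> x) * dominated_potential \<rho> L x \<partial>lborel)"
    using c by (simp add: distrib_right add.assoc)
  finally show ?thesis .
qed

text \<open>The matter counted in \<open>dominated_potential\<close> has height at most
  \<open>\<rho> x\<close> and mass at most m, so \<open>nn_integral_bounded_potential\<close>
  applies. Making m small is what later allows the internal energy to absorb this bound.\<close>

lemma dominated_potential_bound:
  obtains C :: real where "C > 0"
    "\<And>(\<rho> :: real^3 \<Rightarrow> real) L m x. \<lbrakk>\<rho> \<in> borel_measurable borel; \<And>y. 0 \<le> \<rho> y; 0 < m;
       (\<integral>\<^sup>+y\<in>ball x L. ennreal (\<rho> y) \<partial>lborel) \<le> ennreal m\<rbrakk> \<Longrightarrow>
      dominated_potential \<rho> L x \<le> ennreal (C * m powr (2/3) * \<rho> x powr (1/3))"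
proof -
  obtain C :: real where C: "C > 0"
    "\<And>(g :: real^3 \<Rightarrow> real) s m x. \<lbrakk>g \<in> borel_measurable borel; \<And>y. 0 \<le> g y; \<And>y. g y \<le> s; 0 \<le> s; 0 < m;
       (\<integral>\<^sup>+y. ennreal (g y) \<partial>lborel) \<le> ennreal m\<rbrakk> \<Longrightarrow>
      (\<integral>\<^sup>+y. ennreal (g y / norm (x - y)) \<partial>lborel) \<le> ennreal (C * m powr (2/3) * s powr (1/3))"
    by (rule nn_integral_bounded_potential) blast
  show ?thesis
  proof
    fix \<rho> :: "real^3 \<Rightarrow> real" and L m :: real and x :: "real^3"
    assume [measurable]: "\<rho> \<in> borel_measurable borel" and \<rho>0: "\<And>y. 0 \<le> \<rho> y" and m: "0 < m"
      and mass: "(\<integral>\<^sup>+y\<in>ball x L. ennreal (\<rho> y) \<partial>lborel) \<le> ennreal m"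
    let ?g = "\<lambda>y. if norm (x - y) < L \<and> \<rho> y \<le> \<rho> x then \<rho> y else 0"
    have "(\<integral>\<^sup>+y. ennreal (?g y / norm (x - y)) \<partial>lborel) \<le> ennreal (C * m powr (2/3) * \<rho> x powr (1/3))"
    proof (rule C(2))
      show "?g \<in> borel_measurable borel" by measurable
      have "(\<integral>\<^sup>+y. ennreal (?g y) \<partial>lborel) \<le> (\<integral>\<^sup>+y\<in>ball x L. ennreal (\<rho> y) \<partial>lborel)"
        by (intro nn_integral_mono) (auto simp: indicator_def dist_norm)
      then show "(\<integral>\<^sup>+y. ennreal (?g y) \<partial>lborel) \<le> ennreal m" using mass by simp
    qed (use \<rho>0 m in auto)
    then show "dominated_potential \<rho> L x \<le> ennreal (C * m powr (2/3) * \<rho> x powr (1/3))"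
      unfolding dominated_potential_def by (simp add: if_distrib[of "\<lambda>z. z / _"] cong: if_cong)
  qed (fact C(1))
qed

text \<open>Takes the place of the Hardy-Littlewood-Sobolev inequality. With weight 1 and L = 1 the
  near part reduces to the integral of rho times rho^(1/3), which is finite for rho in L^(4/3); the
  far part is at most the mass.\<close>

lemma gravity_finite:
  assumes [measurable]: "\<rho> \<in> borel_measurable borel" and \<rho>0: "\<And>x. 0 \<le> \<rho> x"
    and mass: "(\<integral>\<^sup>+y. ennreal (\<rho> y) \<partial>lborel) \<le> 1"
    and L43: "(\<integral>\<^sup>+y. ennreal (\<rho> y powr (4/3)) \<partial>lborel) < \<infinity>"
  shows "gravity \<rho> < \<infinity>"
proof -
  obtain C :: real where C: "C > 0"
    "\<And>(\<rho> :: real^3 \<Rightarrow> real) L m x. \<lbrakk>\<rho> \<in> borel_measurable borel; \<And>y. 0 \<le> \<rho> y; 0 < m;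
       (\<integral>\<^sup>+y\<in>ball x L. ennreal (\<rho> y) \<partial>lborel) \<le> ennreal m\<rbrakk> \<Longrightarrow>
      dominated_potential \<rho> L x \<le> ennreal (C * m powr (2/3) * \<rho> x powr (1/3))"
    by (rule dominated_potential_bound) blast
  have D: "dominated_potential \<rho> 1 x \<le> ennreal (C * \<rho> x powr (1/3))" for x
  proof -
    have "(\<integral>\<^sup>+y\<in>ball x 1. ennreal (\<rho> y) \<partial>lborel) \<le> (\<integral>\<^sup>+y. ennreal (\<rho> y) \<partial>lborel)"
      by (intro nn_integral_mono) (auto simp: indicator_def)
    then have "(\<integral>\<^sup>+y\<in>ball x 1. ennreal (\<rho> y) \<partial>lborel) \<le> ennreal 1" using mass by simp
    then show ?thesis using C(2)[of \<rho> 1 x 1] \<rho>0 by simp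
  qed
  have "gravity \<rho> = (\<integral>\<^sup>+x. ennreal (1 * \<rho> x) * potential \<rho> x \<partial>lborel)"
    unfolding gravity_def by (simp add: mult.commute)
  also have "\<dots> \<le> ennreal (1/1) * (\<integral>\<^sup>+x. ennreal (1 * \<rho> x) \<partial>lborel)
      + ennreal (1 + 1) * (\<integral>\<^sup>+x. ennreal (1 * \<rho> x) * dominated_potential \<rho> 1 x \<partial>lborel)"
    using mass \<rho>0 by (intro weighted_potential_bound) auto
  also have "\<dots> \<le> ennreal (1/1) * 1
      + ennreal (1 + 1) * (\<integral>\<^sup>+x. ennreal C * ennreal (\<rho> x powr (4/3)) \<partial>lborel)"
  proof (intro add_mono mult_left_mono nn_integral_mono)
    fix x
    have "ennreal (1 * \<rho> x) * dominated_potential \<rho> 1 x \<le> ennreal (\<rho> x) * ennreal (C * \<rho> x powr (1/3))"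
      using mult_left_mono[OF D, of "ennreal (\<rho> x)"] by simp
    also have "\<dots> = ennreal C * ennreal (\<rho> x powr (4/3))"
    proof -
      have "\<rho> x * \<rho> x powr (1/3) = \<rho> x powr 1 * \<rho> x powr (1/3)" using \<rho>0 by simp
      also have "\<dots> = \<rho> x powr (4/3)" unfolding powr_add[symmetric] by simp
      finally show ?thesis using \<rho>0[of x] C(1)
        by (simp add: algebra_simps flip: ennreal_mult)
    qed
    finally show "ennreal (1 * \<rho> x) * dominated_potential \<rho> 1 x \<le> ennreal C * ennreal (\<rho> x powr (4/3))" .
  qed (use mass in auto)
  also have "\<dots> < \<infinity>"
    using L43 by (auto simp: nn_integral_cmult ennreal_mult_less_top ennreal_add_less_top)
  finally show ?thesis .
qed

section \<open>Densities and segments between them\<close>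

lemma moment_of_inertia_cong_AE:
  assumes [measurable]: "\<rho> \<in> borel_measurable borel" "\<rho>' \<in> borel_measurable borel"
    and eq: "AE x in lborel. \<rho> x = \<rho>' x"
  shows "moment_of_inertia \<rho> = moment_of_inertia \<rho>'"
proof -
  have "center_of_mass \<rho> = center_of_mass \<rho>'"
    unfolding center_of_mass_def
  proof (intro arg_cong[of _ _ vec_lambda] ext arg_cong2[of _ _ _ _ "(/)"])
    show "(LINT x|lborel. x $ i * \<rho> x) = (LINT x|lborel. x $ i * \<rho>' x)" for i
      using eq by (intro integral_cong_AE) auto
    show "(LINT x|lborel. \<rho> x) = (LINT x|lborel. \<rho>' x)"
      using eq by (intro integral_cong_AE) auto
  qed
  moreover have "(\<integral>\<^sup>+x. ennreal ((axis_dist x)\<^sup>2 * \<rho> x) \<partial>lborel)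
      = (\<integral>\<^sup>+x. ennreal ((axis_dist x)\<^sup>2 * \<rho>' x) \<partial>lborel)"
    using eq by (intro nn_integral_cong_AE) auto
  moreover have "(\<integral>\<^sup>+x. ennreal (\<rho> x * (axis_dist (x - c))\<^sup>2) \<partial>lborel)
      = (\<integral>\<^sup>+x. ennreal (\<rho>' x * (axis_dist (x - c))\<^sup>2) \<partial>lborel)" for c
    using eq by (intro nn_integral_cong_AE) auto
  ultimately show ?thesis by (simp add: moment_of_inertia_def)
qed

lemma energy_cong_AE:
  assumes [measurable]: "\<rho> \<in> borel_measurable borel" "\<rho>' \<in> borel_measurable borel"
    and eq: "AE x in lborel. \<rho> x = \<rho>' x"
  shows "energy P J \<rho> = energy P J \<rho>'"
proof -
  have "internal_energy P \<rho> = internal_energy P \<rho>'"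
    unfolding internal_energy_def using eq by (intro nn_integral_cong_AE) auto
  moreover have "potential \<rho> = potential \<rho>'"
    unfolding potential_def[abs_def] using eq by (intro ext nn_integral_cong_AE) auto
  then have "gravity \<rho> = gravity \<rho>'"
    unfolding gravity_def using eq by (intro nn_integral_cong_AE) auto
  ultimately show ?thesis
    unfolding energy_def using moment_of_inertia_cong_AE[OF assms] by simp
qed

lemma densities_nonneg_iff:
  assumes "\<And>x. 0 \<le> \<rho> x"
  shows "\<rho> \<in> densities \<longleftrightarrow> \<rho> \<in> borel_measurable borel \<and>
    (\<integral>\<^sup>+x. ennreal (\<rho> x powr (4/3)) \<partial>lborel) < \<infinity> \<and> (\<integral>\<^sup>+x. ennreal (\<rho> x) \<partial>lborel) = 1"
proof
  assume d: "\<rho> \<in> densities"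
  then have "(\<integral>\<^sup>+x. ennreal (\<rho> x) \<partial>lborel) = ennreal (LINT x|lborel. \<rho> x)"
    using assms by (intro nn_integral_eq_integral) (auto simp: densities_def)
  then show "\<rho> \<in> borel_measurable borel \<and>
    (\<integral>\<^sup>+x. ennreal (\<rho> x powr (4/3)) \<partial>lborel) < \<infinity> \<and> (\<integral>\<^sup>+x. ennreal (\<rho> x) \<partial>lborel) = 1"
    using d assms by (auto simp: densities_def integrable_iff_bounded)
next
  assume d: "\<rho> \<in> borel_measurable borel \<and>
    (\<integral>\<^sup>+x. ennreal (\<rho> x powr (4/3)) \<partial>lborel) < \<infinity> \<and> (\<integral>\<^sup>+x. ennreal (\<rho> x) \<partial>lborel) = 1"
  then have i: "integrable lborel \<rho>" using assms by (auto simp: integrable_iff_bounded)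
  then have "ennreal (LINT x|lborel. \<rho> x) = 1"
    using d assms nn_integral_eq_integral[OF i] by simp
  then have "(LINT x|lborel. \<rho> x) = 1"
    by (metis ennreal_1 ennreal_inj integral_nonneg_AE assms always_eventually zero_le_one)
  then show "\<rho> \<in> densities"
    using d i assms by (auto simp: densities_def integrable_iff_bounded)
qed

text \<open>Membership in \<open>densities\<close> gives nonnegativity only almost everywhere. This
  representative is nonnegative everywhere, so that nonnegative integrals can be used without
  exceptional sets; \<open>energy_cong_AE\<close> shows that the energy does not see the
  change.\<close>

lemma densities_positive_part:
  assumes "\<rho> \<in> densities"
  shows "(\<lambda>x. max 0 (\<rho> x)) \<in> densities" "AE x in lborel. \<rho> x = max 0 (\<rho> x)"
proof -
  have m[measurable]: "\<rho> \<in> borel_measurable borel" using assms by (simp add: densities_def)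
  show eq: "AE x in lborel. \<rho> x = max 0 (\<rho> x)" using assms by (auto simp: densities_def)
  have "integrable lborel (\<lambda>x. \<bar>max 0 (\<rho> x)\<bar> powr (4/3)) \<longleftrightarrow> integrable lborel (\<lambda>x. \<bar>\<rho> x\<bar> powr (4/3))"
    using eq by (intro integrable_cong_AE) auto
  moreover have "integrable lborel (\<lambda>x. max 0 (\<rho> x)) \<longleftrightarrow> integrable lborel \<rho>"
    using eq by (intro integrable_cong_AE) auto
  moreover have "(LINT x|lborel. max 0 (\<rho> x)) = (LINT x|lborel. \<rho> x)"
    using eq by (intro integral_cong_AE) auto
  ultimately show "(\<lambda>x. max 0 (\<rho> x)) \<in> densities" using assms by (simp add: densities_def)
qed

lemma densities_convex:
  assumes \<rho>: "\<rho> \<in> densities" "\<And>x. 0 \<le> \<rho> x" and \<sigma>: "\<sigma> \<in> densities" "\<And>x. 0 \<le> \<sigma> x"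
    and t: "0 \<le> t" "t \<le> 1"
  shows "(\<lambda>x. (1 - t) * \<rho> x + t * \<sigma> x) \<in> densities"
proof -
  have D: "\<rho> \<in> borel_measurable borel" "(\<integral>\<^sup>+x. ennreal (\<rho> x powr (4/3)) \<partial>lborel) < \<infinity>"
      "(\<integral>\<^sup>+x. ennreal (\<rho> x) \<partial>lborel) = 1"
     "\<sigma> \<in> borel_measurable borel" "(\<integral>\<^sup>+x. ennreal (\<sigma> x powr (4/3)) \<partial>lborel) < \<infinity>"
      "(\<integral>\<^sup>+x. ennreal (\<sigma> x) \<partial>lborel) = 1"
    using densities_nonneg_iff[of \<rho>] densities_nonneg_iff[of \<sigma>] \<rho> \<sigma> by auto
  note [measurable] = D(1,4)
  have nn: "0 \<le> (1 - t) * \<rho> x + t * \<sigma> x" for x using \<rho> \<sigma> t by simp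
  have "(\<integral>\<^sup>+x. ennreal (((1 - t) * \<rho> x + t * \<sigma> x) powr (4/3)) \<partial>lborel)
      \<le> (\<integral>\<^sup>+x. ennreal (\<rho> x powr (4/3)) + ennreal (\<sigma> x powr (4/3)) \<partial>lborel)"
  proof (intro nn_integral_mono)
    fix x
    have "(1 - t) * \<rho> x + t * \<sigma> x \<le> max (\<rho> x) (\<sigma> x)"
      using t by (intro convex_bound_le) auto
    then have "((1 - t) * \<rho> x + t * \<sigma> x) powr (4/3) \<le> (max (\<rho> x) (\<sigma> x)) powr (4/3)"
      using nn by (intro powr_mono2) auto
    also have "\<dots> \<le> \<rho> x powr (4/3) + \<sigma> x powr (4/3)" by (auto simp: max_def)
    finally show "ennreal (((1 - t) * \<rho> x + t * \<sigma> x) powr (4/3))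
        \<le> ennreal (\<rho> x powr (4/3)) + ennreal (\<sigma> x powr (4/3))"
      by (simp add: ennreal_leI flip: ennreal_plus)
  qed
  also have "\<dots> < \<infinity>" using D by (simp add: nn_integral_add)
  finally have 1: "(\<integral>\<^sup>+x. ennreal (((1 - t) * \<rho> x + t * \<sigma> x) powr (4/3)) \<partial>lborel) < \<infinity>" .
  have "(\<integral>\<^sup>+x. ennreal ((1 - t) * \<rho> x + t * \<sigma> x) \<partial>lborel)
     = (\<integral>\<^sup>+x. ennreal (1 - t) * ennreal (\<rho> x) + ennreal t * ennreal (\<sigma> x) \<partial>lborel)"
    using \<rho> \<sigma> t by (intro nn_integral_cong) (simp flip: ennreal_mult ennreal_plus)
  also have "\<dots> = ennreal (1 - t) + ennreal t"
    using D by (simp add: nn_integral_add nn_integral_cmult)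
  also have "\<dots> = 1" using t by (simp flip: ennreal_plus)
  finally show ?thesis using 1 nn by (subst densities_nonneg_iff) auto
qed

section \<open>Segments in a vector space topology\<close>

text \<open>Under \<open>j\<close> the segment becomes a curve in Y that is continuous by continuity
  of the operations and starts at the class of \<open>\<rho>\<close>. Local minimality is given for
  \<open>\<rho>\<close>, while the estimates need its nonnegative representative
  \<open>\<rho>'\<close>; an open set of the pullback topology contains both or neither.\<close>

lemma local_minimizer_segment:
  assumes incl: "inclusion_into_tvs densities j Y"
    and min: "local_minimizer (pullback_topology densities j Y) E \<rho>"
    and \<rho>: "\<rho> \<in> densities" "\<rho>' \<in> densities" "AE x in lborel. \<rho> x = \<rho>' x"
    and \<sigma>: "\<sigma> \<in> densities"
    and seg: "\<And>t. 0 \<le> t \<Longrightarrow> t \<le> 1 \<Longrightarrow> (\<lambda>x. (1 - t) * \<rho>' x + t * \<sigma> x) \<in> densities"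
  shows "\<exists>t0>0. t0 \<le> 1 \<and> (\<forall>t. 0 < t \<longrightarrow> t < t0 \<longrightarrow>
    E \<rho> \<le> E (\<lambda>x. (1 - t) * \<rho>' x + t * \<sigma> x))"
proof -
  have span: "(\<lambda>x. c * f x) \<in> function_span densities" if "f \<in> densities" for f c
    unfolding function_span_def using that by (auto intro!: exI[of _ "{f}"] exI[of _ "\<lambda>_. c"])
  have span1: "f \<in> function_span densities" if "f \<in> densities" for f
    using span[OF that, of 1] by simp
  have tvs: "topological_vector_space Y"
    and jeq: "\<And>f g. f \<in> function_span densities \<Longrightarrow> g \<in> function_span densities \<Longrightarrow>
        j f = j g \<longleftrightarrow> (AE x in lborel. f x = g x)"
    and jadd: "\<And>f g. f \<in> function_span densities \<Longrightarrow> g \<in> function_span densities \<Longrightarrow>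
        j (\<lambda>x. f x + g x) = j f + j g"
    and jscale: "\<And>f c. f \<in> function_span densities \<Longrightarrow> j (\<lambda>x. c * f x) = c *\<^sub>R j f"
    and jY: "\<And>f. f \<in> function_span densities \<Longrightarrow> j f \<in> topspace Y"
    using incl unfolding inclusion_into_tvs_def by auto
  have add: "continuous_map (prod_topology Y Y) Y (\<lambda>(u, v). u + v)"
    and scale: "continuous_map (prod_topology euclideanreal Y) Y (\<lambda>(c, v). c *\<^sub>R v)"
    using tvs unfolding topological_vector_space_def by auto
  have sc: "continuous_map euclideanreal Y (\<lambda>t. a t *\<^sub>R v)"
    if "continuous_on UNIV a" "v \<in> topspace Y" for a :: "real \<Rightarrow> real" and v
  proof -
    have "continuous_map euclideanreal (prod_topology euclideanreal Y) (\<lambda>t. (a t, v))"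
      using that by (intro continuous_map_pairedI) auto
    from continuous_map_compose[OF this scale] show ?thesis by (simp add: o_def)
  qed
  define h where "h t = (1 - t) *\<^sub>R j \<rho>' + t *\<^sub>R j \<sigma>" for t
  have "continuous_map euclideanreal (prod_topology Y Y) (\<lambda>t. ((1 - t) *\<^sub>R j \<rho>', t *\<^sub>R j \<sigma>))"
    by (intro continuous_map_pairedI sc continuous_intros jY span1 \<rho> \<sigma>)
  from continuous_map_compose[OF this add]
  have h: "continuous_map euclideanreal Y h" by (simp add: o_def h_def[abs_def])
  have hj: "h t = j (\<lambda>x. (1 - t) * \<rho>' x + t * \<sigma> x)" for t
    unfolding h_def using jadd[OF span span, of \<rho>' \<sigma> "1 - t" t] jscale[OF span1] \<rho> \<sigma> by simp
  obtain N W where NW: "openin (pullback_topology densities j Y) W" "\<rho> \<in> W" "W \<subseteq> N"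
      "\<forall>\<kappa>\<in>N. E \<rho> \<le> E \<kappa>"
    using min unfolding local_minimizer_def by blast
  then obtain U where U: "openin Y U" "W = j -` U \<inter> densities"
    by (auto simp: openin_pullback_topology)
  have "open {t. h t \<in> U}"
    using h U(1) unfolding continuous_map_def by simp
  moreover have "j \<rho>' = j \<rho>" using jeq[OF span1 span1] \<rho> by auto
  then have "0 \<in> {t. h t \<in> U}" using NW U by (simp add: h_def)
  ultimately obtain e where e: "e > 0" "ball 0 e \<subseteq> {t. h t \<in> U}"
    by (auto simp: open_contains_ball)
  show ?thesis
  proof (intro exI conjI allI impI)
    show "0 < min e 1" "min e 1 \<le> 1" using e by auto
    fix t assume t: "0 < t" "t < min e 1"
    then have "t \<in> ball 0 e" by simp
    then have "h t \<in> U" using e by blast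
    then have "(\<lambda>x. (1 - t) * \<rho>' x + t * \<sigma> x) \<in> W" using U seg[of t] t by (simp add: hj)
    then show "E \<rho> \<le> E (\<lambda>x. (1 - t) * \<rho>' x + t * \<sigma> x)" using NW by blast
  qed
qed

section \<open>Bounded densities\<close>

text \<open>A height bound b turns both integrals into multiples of the mass: s^(4/3) is at most
  b^(1/3) s, and A(s) is at most s times the value of \<open>specific_energy\<close> at b.\<close>

lemma densities_internal_energy_bounded:
  assumes P: "pressure P" "small_density_condition P"
    and [measurable]: "\<sigma> \<in> borel_measurable borel" and b: "\<And>x. 0 \<le> \<sigma> x" "\<And>x. \<sigma> x \<le> b"
    and mass: "(\<integral>\<^sup>+x. ennreal (\<sigma> x) \<partial>lborel) = 1"
  shows "\<sigma> \<in> densities" "internal_energy P \<sigma> < \<infinity>"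
proof -
  have "(\<integral>\<^sup>+x. ennreal (\<sigma> x powr (4/3)) \<partial>lborel)
      \<le> (\<integral>\<^sup>+x. ennreal (b powr (1/3)) * ennreal (\<sigma> x) \<partial>lborel)"
  proof (intro nn_integral_mono)
    fix x
    have "\<sigma> x powr (4/3) = \<sigma> x powr (1/3) * \<sigma> x powr 1" unfolding powr_add[symmetric] by simp
    also have "\<dots> \<le> b powr (1/3) * \<sigma> x powr 1"
      using b by (intro mult_right_mono powr_mono2) auto
    finally show "ennreal (\<sigma> x powr (4/3)) \<le> ennreal (b powr (1/3)) * ennreal (\<sigma> x)"
      using b by (simp add: ennreal_leI flip: ennreal_mult)
  qed
  also have "\<dots> < \<infinity>" using mass by (simp add: nn_integral_cmult)
  finally show "\<sigma> \<in> densities" using mass b by (subst densities_nonneg_iff) auto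
  have "internal_energy P \<sigma> \<le> (\<integral>\<^sup>+x. ennreal (specific_energy P b) * ennreal (\<sigma> x) \<partial>lborel)"
    unfolding internal_energy_def
  proof (intro nn_integral_mono)
    fix x
    have "internal_density P (\<sigma> x) \<le> \<sigma> x * specific_energy P b"
      unfolding internal_density_eq using b monoD[OF mono_specific_energy[OF P]]
      by (intro mult_left_mono) auto
    then show "ennreal (internal_density P (\<sigma> x)) \<le> ennreal (specific_energy P b) * ennreal (\<sigma> x)"
      using b specific_energy_nonneg[OF P(1)]
      by (simp add: ennreal_leI mult.commute flip: ennreal_mult)
  qed
  also have "\<dots> < \<infinity>" using mass by (simp add: nn_integral_cmult)
  finally show "internal_energy P \<sigma> < \<infinity>" .
qed

lemma borel_measurable_axis_dist [measurable]: "axis_dist \<in> borel_measurable borel"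
  unfolding axis_dist_def[abs_def] by measurable

text \<open>Balls escaping along the first axis at distance \<open>2 ^ Suc k\<close> with masses \<open>(1/2) ^ Suc k\<close>.\<close>

lemma bounded_density_infinite_second_moment:
  obtains \<sigma> :: "real^3 \<Rightarrow> real" and b where "\<sigma> \<in> borel_measurable borel"
    "\<And>x. 0 \<le> \<sigma> x" "\<And>x. \<sigma> x \<le> b" "(\<integral>\<^sup>+x. ennreal (\<sigma> x) \<partial>lborel) = 1"
    "(\<integral>\<^sup>+x. ennreal ((axis_dist x)\<^sup>2 * \<sigma> x) \<partial>lborel) = \<infinity>"
proof -
  define \<kappa> where "\<kappa> = unit_ball_vol (real CARD(3))"
  have \<kappa>: "\<kappa> > 0" unfolding \<kappa>_def by simp
  define Q :: "nat \<Rightarrow> (real^3) set" where "Q k = ball (axis 1 (2 ^ Suc k)) 1" for k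
  have [measurable]: "Q k \<in> sets borel" for k by (simp add: Q_def)
  \<comment> \<open>Division by the volume of the unit ball gives the ball \<open>Q k\<close>
    exactly the mass (1/2)^(k+1).\<close>
  define c where "c k = (1/2)^Suc k / \<kappa>" for k :: nat
  have c: "c k > 0" for k using \<kappa> by (simp add: c_def)
  have csums: "c sums (1 / \<kappa>)"
    unfolding c_def[abs_def] using power_half_series by (intro sums_divide) 
  define \<sigma> where "\<sigma> x = (\<Sum>k. c k * indicator (Q k) x)" for x
  have summ: "summable (\<lambda>k. c k * indicator (Q k) x)" for x
    by (rule summable_comparison_test'[OF sums_summable[OF csums], of 0])
       (use c in \<open>auto simp: indicator_def less_imp_le\<close>)
  have nn: "0 \<le> c k * indicator (Q k) x" for k x using c[of k] by (simp add: less_imp_le)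
  have [measurable]: "\<sigma> \<in> borel_measurable borel" unfolding \<sigma>_def[abs_def] by measurable
  have \<sigma>0: "0 \<le> \<sigma> x" for x unfolding \<sigma>_def using summ nn by (intro suminf_nonneg)
  have \<sigma>b: "\<sigma> x \<le> 1 / \<kappa>" for x
    unfolding \<sigma>_def sums_unique[OF csums]
    by (intro suminf_le summ sums_summable[OF csums]) (use c in \<open>auto simp: indicator_def less_imp_le\<close>)
  have vol: "(\<integral>\<^sup>+x. ennreal (c k * indicator (Q k) x) \<partial>lborel) = ennreal ((1/2)^Suc k)" for k
  proof -
    have "(\<integral>\<^sup>+x. ennreal (c k * indicator (Q k) x) \<partial>lborel)
        = (\<integral>\<^sup>+x. ennreal (c k) * indicator (Q k) x \<partial>lborel)"
      by (intro nn_integral_cong) (auto simp: indicator_def)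
    also have "\<dots> = ennreal (c k) * ennreal \<kappa>"
      by (simp add: nn_integral_cmult_indicator Q_def emeasure_ball \<kappa>_def)
    also have "\<dots> = ennreal ((1/2)^Suc k)"
      using \<kappa> c[of k] by (subst ennreal_mult[symmetric]) (auto simp: c_def)
    finally show ?thesis .
  qed
  have "(\<integral>\<^sup>+x. ennreal (\<sigma> x) \<partial>lborel) = (\<integral>\<^sup>+x. (\<Sum>k. ennreal (c k * indicator (Q k) x)) \<partial>lborel)"
    unfolding \<sigma>_def using summ nn by (intro nn_integral_cong suminf_ennreal2[symmetric])
  also have "\<dots> = (\<Sum>k. \<integral>\<^sup>+x. ennreal (c k * indicator (Q k) x) \<partial>lborel)"
    by (rule nn_integral_suminf) measurable
  also have "\<dots> = (\<Sum>k. ennreal ((1/2)^Suc k))" by (simp only: vol)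
  also have "\<dots> = ennreal 1"
    using power_half_series by (intro suminf_ennreal_eq) auto
  finally have mass: "(\<integral>\<^sup>+x. ennreal (\<sigma> x) \<partial>lborel) = 1" by simp
  \<comment> \<open>Single balls suffice: in \<open>Q k\<close> the first coordinate exceeds 2^(k+1)
    - 1, hence is at least 2^k, so this ball contributes at least 4^k (1/2)^(k+1), which is
    unbounded in k.\<close>
  have lower: "ennreal (2^k / 2) \<le> (\<integral>\<^sup>+x. ennreal ((axis_dist x)\<^sup>2 * \<sigma> x) \<partial>lborel)" for k
  proof -
    have "ennreal (2^k / 2) = ennreal (4^k) * ennreal ((1/2)^Suc k)"
    proof -
      have "(4::real)^k = 2^k * 2^k" by (simp flip: power_mult_distrib)
      then show ?thesis by (subst ennreal_mult[symmetric]) (auto simp: power_divide)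
    qed
    also have "\<dots> = (\<integral>\<^sup>+x. ennreal (4^k) * ennreal (c k * indicator (Q k) x) \<partial>lborel)"
      unfolding vol[symmetric] by (rule nn_integral_cmult[symmetric]) measurable
    also have "\<dots> \<le> (\<integral>\<^sup>+x. ennreal ((axis_dist x)\<^sup>2 * \<sigma> x) \<partial>lborel)"
    proof (intro nn_integral_mono)
      fix x
      have 1: "c k * indicator (Q k) x \<le> \<sigma> x"
      proof -
        have "c k * indicator (Q k) x = (\<Sum>i\<in>{k}. c i * indicator (Q i) x)"
          by (simp only: sum.insert finite.emptyI empty_iff not_False_eq_True sum.empty add_0_right)
        also have "\<dots> \<le> \<sigma> x"
          unfolding \<sigma>_def using nn by (intro sum_le_suminf summ) auto
        finally show ?thesis .
      qed
      have "4^k * (c k * indicator (Q k) x) \<le> (axis_dist x)\<^sup>2 * \<sigma> x"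
      proof (cases "x \<in> Q k")
        case True
        have "\<bar>(axis 1 (2 ^ Suc k) - x) $ 1\<bar> \<le> norm (axis 1 (2 ^ Suc k) - x)"
          by (rule component_le_norm_cart)
        also have "\<dots> < 1" using True by (simp add: Q_def dist_norm)
        finally have "x $ 1 > 2 ^ Suc k - 1" by (simp add: axis_def abs_less_iff)
        moreover have "(1::real) \<le> 2^k" by simp
        ultimately have "2^k \<le> x $ 1" unfolding power_Suc by linarith
        then have "(2^k)\<^sup>2 \<le> (x $ 1)\<^sup>2" by (intro power_mono) auto
        also have "\<dots> \<le> (axis_dist x)\<^sup>2" by (simp add: axis_dist_def)
        finally have "4^k \<le> (axis_dist x)\<^sup>2"
          by (simp add: power2_eq_square flip: power_mult_distrib)
        then show ?thesis using 1 nn by (intro mult_mono) auto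
      next
        case False
        then show ?thesis using \<sigma>0 by simp
      qed
      then show "ennreal (4^k) * ennreal (c k * indicator (Q k) x) \<le> ennreal ((axis_dist x)\<^sup>2 * \<sigma> x)"
        using nn[of k x] by (subst ennreal_mult[symmetric]) (auto intro: ennreal_leI)
    qed
    finally show ?thesis .
  qed
  have "(\<integral>\<^sup>+x. ennreal ((axis_dist x)\<^sup>2 * \<sigma> x) \<partial>lborel) = \<infinity>"
  proof (rule ccontr)
    assume "(\<integral>\<^sup>+x. ennreal ((axis_dist x)\<^sup>2 * \<sigma> x) \<partial>lborel) \<noteq> \<infinity>"
    then obtain r where r: "r \<ge> 0" "(\<integral>\<^sup>+x. ennreal ((axis_dist x)\<^sup>2 * \<sigma> x) \<partial>lborel) = ennreal r"
      by (cases "\<integral>\<^sup>+x. ennreal ((axis_dist x)\<^sup>2 * \<sigma> x) \<partial>lborel") auto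
    obtain k :: nat where "2 * r < 2^k" using real_arch_pow[of 2 "2 * r"] by auto
    then show False using lower[of k] r by (simp add: ennreal_le_iff)
  qed
  then show ?thesis using that \<open>\<sigma> \<in> borel_measurable borel\<close> \<sigma>0 \<sigma>b mass by blast
qed

section \<open>Minimizers with finite second moment\<close>

lemma moment_of_inertia_eq_top:
  "(\<integral>\<^sup>+x. ennreal ((axis_dist x)\<^sup>2 * \<rho> x) \<partial>lborel) = \<infinity> \<Longrightarrow> moment_of_inertia \<rho> = \<infinity>"
  by (simp add: moment_of_inertia_def)

text \<open>An infinite second moment about the axis makes the moment of inertia infinite by
  convention, wherever the center of mass lies. The second moment is monotone in the density, so any
  fixed share of a density with infinite second moment is enough to remove the rotational
  energy.\<close>

lemma moment_of_inertia_infinite_mono: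
  assumes [measurable]: "\<sigma> \<in> borel_measurable borel" and \<sigma>0: "\<And>x. 0 \<le> \<sigma> x"
    and c: "0 < c" and le: "\<And>x. c * \<sigma> x \<le> \<kappa> x"
    and \<sigma>2: "(\<integral>\<^sup>+x. ennreal ((axis_dist x)\<^sup>2 * \<sigma> x) \<partial>lborel) = \<infinity>"
  shows "moment_of_inertia \<kappa> = \<infinity>"
proof -
  have "\<infinity> = ennreal c * (\<integral>\<^sup>+x. ennreal ((axis_dist x)\<^sup>2 * \<sigma> x) \<partial>lborel)"
    using \<sigma>2 c by (simp add: ennreal_mult_top)
  also have "\<dots> = (\<integral>\<^sup>+x. ennreal c * ennreal ((axis_dist x)\<^sup>2 * \<sigma> x) \<partial>lborel)"
    by (rule nn_integral_cmult[symmetric]) measurable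
  also have "\<dots> \<le> (\<integral>\<^sup>+x. ennreal ((axis_dist x)\<^sup>2 * \<kappa> x) \<partial>lborel)"
  proof (intro nn_integral_mono)
    fix x
    have "(axis_dist x)\<^sup>2 * (c * \<sigma> x) \<le> (axis_dist x)\<^sup>2 * \<kappa> x"
      by (intro mult_left_mono le) auto
    then show "ennreal c * ennreal ((axis_dist x)\<^sup>2 * \<sigma> x) \<le> ennreal ((axis_dist x)\<^sup>2 * \<kappa> x)"
      using c \<sigma>0[of x] by (subst ennreal_mult[symmetric])
        (auto intro!: ennreal_leI simp: algebra_simps)
  qed
  finally show ?thesis by (intro moment_of_inertia_eq_top) (simp add: top_unique)
qed

lemma axis_dist_diff_bound: "(axis_dist (x - c))\<^sup>2 \<le> 2 * (axis_dist x)\<^sup>2 + 2 * (axis_dist c)\<^sup>2"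
proof -
  have "(a - b)\<^sup>2 \<le> 2 * a\<^sup>2 + 2 * b\<^sup>2" for a b :: real
    using zero_le_power2[of "a + b"] by (simp add: power2_eq_square algebra_simps)
  from this[of "x $ 1" "c $ 1"] this[of "x $ 2" "c $ 2"]
  show ?thesis by (simp add: axis_dist_def)
qed

lemma moment_of_inertia_finite:
  assumes [measurable]: "\<rho> \<in> borel_measurable borel" and \<rho>0: "\<And>x. 0 \<le> \<rho> x"
    and mass: "(\<integral>\<^sup>+x. ennreal (\<rho> x) \<partial>lborel) = 1"
    and fin: "(\<integral>\<^sup>+x. ennreal ((axis_dist x)\<^sup>2 * \<rho> x) \<partial>lborel) \<noteq> \<infinity>"
  shows "moment_of_inertia \<rho> < \<infinity>"
proof -
  define c where "c = center_of_mass \<rho>"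
  have "moment_of_inertia \<rho> = (\<integral>\<^sup>+x. ennreal (\<rho> x * (axis_dist (x - c))\<^sup>2) \<partial>lborel)"
    using fin by (simp add: moment_of_inertia_def c_def)
  also have "\<dots> \<le> (\<integral>\<^sup>+x. ennreal 2 * ennreal ((axis_dist x)\<^sup>2 * \<rho> x)
      + ennreal (2 * (axis_dist c)\<^sup>2) * ennreal (\<rho> x) \<partial>lborel)"
  proof (intro nn_integral_mono)
    fix x
    have "\<rho> x * (axis_dist (x - c))\<^sup>2 \<le> \<rho> x * (2 * (axis_dist x)\<^sup>2 + 2 * (axis_dist c)\<^sup>2)"
      by (intro mult_left_mono axis_dist_diff_bound \<rho>0)
    then have "\<rho> x * (axis_dist (x - c))\<^sup>2
        \<le> 2 * ((axis_dist x)\<^sup>2 * \<rho> x) + 2 * (axis_dist c)\<^sup>2 * \<rho> x"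
      by (simp add: algebra_simps)
    then show "ennreal (\<rho> x * (axis_dist (x - c))\<^sup>2) \<le> ennreal 2 * ennreal ((axis_dist x)\<^sup>2 * \<rho> x)
      + ennreal (2 * (axis_dist c)\<^sup>2) * ennreal (\<rho> x)"
      using \<rho>0[of x] by (simp only: ennreal_leI mult_nonneg_nonneg zero_le_power2 zero_le_numeral
        flip: ennreal_mult ennreal_plus)
  qed
  also have "\<dots> = ennreal 2 * (\<integral>\<^sup>+x. ennreal ((axis_dist x)\<^sup>2 * \<rho> x) \<partial>lborel)
      + ennreal (2 * (axis_dist c)\<^sup>2) * (\<integral>\<^sup>+x. ennreal (\<rho> x) \<partial>lborel)"
    by (simp add: nn_integral_add nn_integral_cmult)
  also have "\<dots> < \<infinity>"
    using fin mass by (auto simp: ennreal_mult_less_top less_top)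
  finally show ?thesis .
qed

lemma energy_cases_inertia:
  assumes "internal_energy P \<rho> = ennreal u" "0 \<le> u" "gravity \<rho> = ennreal g" "0 \<le> g"
  shows "moment_of_inertia \<rho> = \<infinity> \<Longrightarrow> energy P J \<rho> = ereal (u - g / 2)"
    and "moment_of_inertia \<rho> < \<infinity> \<Longrightarrow> J > 0 \<Longrightarrow> \<exists>e>0. ereal (u - g / 2 + e) \<le> energy P J \<rho>"
proof -
  define q where "q = ereal (J\<^sup>2) / (2 * enn2ereal (moment_of_inertia \<rho>))"
  have E: "energy P J \<rho> = ereal (u - g / 2) + q"
    using assms by (simp add: energy_def q_def enn2ereal_ennreal)
  show "energy P J \<rho> = ereal (u - g / 2)" if "moment_of_inertia \<rho> = \<infinity>"
    using that by (simp add: E q_def)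
  show "\<exists>e>0. ereal (u - g / 2 + e) \<le> energy P J \<rho>" if fin: "moment_of_inertia \<rho> < \<infinity>" and J: "J > 0"
  proof -
    obtain i where i: "i \<ge> 0" "moment_of_inertia \<rho> = ennreal i"
      using fin by (cases "moment_of_inertia \<rho>") auto
    show ?thesis
    proof (cases "i = 0")
      case True
      \<comment> \<open>In \<open>ereal\<close> a positive number divided by 0 is infinite, so this
        degenerate case also leaves a positive excess.\<close>
      then have "q = \<infinity>" using i J by (simp add: q_def zero_ennreal.rep_eq divide_ereal_def)
      then show ?thesis unfolding E by (intro exI[of _ 1]) auto
    next
      case False
      then have "q = ereal (J\<^sup>2 / (2 * i))" using i by (simp add: q_def enn2ereal_ennreal)
      moreover have "J\<^sup>2 / (2 * i) > 0" using False i J by simp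
      ultimately show ?thesis unfolding E by (intro exI[of _ "J\<^sup>2 / (2 * i)"]) simp
    qed
  qed
qed

text \<open>In \<open>ereal\<close> the sum of infinity and minus infinity is infinity, so no
  finiteness of \<open>gravity\<close> enters. The contrapositive turns finite energy into finite
  internal energy.\<close>

lemma internal_energy_infinite:
  assumes "internal_energy P \<rho> = \<infinity>"
  shows "energy P J \<rho> = \<infinity>"
proof -
  have "0 \<le> ereal (J\<^sup>2) / (2 * enn2ereal (moment_of_inertia \<rho>))"
    by (cases "moment_of_inertia \<rho>") (auto simp: enn2ereal_ennreal divide_ereal_def)
  then show ?thesis using assms by (simp add: energy_def)
qed

lemma gravity_eq:
  assumes [measurable]: "\<rho> \<in> borel_measurable borel" and "\<And>x. 0 \<le> \<rho> x"
  shows "gravity \<rho> = (\<integral>\<^sup>+x. \<integral>\<^sup>+y. ennreal (\<rho> x * \<rho> y / norm (x - y)) \<partial>lborel \<partial>lborel)"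
  unfolding gravity_def potential_def
proof (intro nn_integral_cong)
  fix x
  have "(\<integral>\<^sup>+y. ennreal (\<rho> y / norm (x - y)) \<partial>lborel) * ennreal (\<rho> x)
     = (\<integral>\<^sup>+y. ennreal (\<rho> y / norm (x - y)) * ennreal (\<rho> x) \<partial>lborel)"
    by (simp add: nn_integral_multc)
  also have "\<dots> = (\<integral>\<^sup>+y. ennreal (\<rho> x * \<rho> y / norm (x - y)) \<partial>lborel)"
    using assms by (intro nn_integral_cong) (simp add: mult.commute flip: ennreal_mult)
  finally show "(\<integral>\<^sup>+y. ennreal (\<rho> y / norm (x - y)) \<partial>lborel) * ennreal (\<rho> x)
     = (\<integral>\<^sup>+y. ennreal (\<rho> x * \<rho> y / norm (x - y)) \<partial>lborel)" .
qed

lemma gravity_scaled_le: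
  assumes [measurable]: "\<rho> \<in> borel_measurable borel" "\<kappa> \<in> borel_measurable borel"
    and \<rho>0: "\<And>x. 0 \<le> \<rho> x" and c: "0 \<le> c" and le: "\<And>x. c * \<rho> x \<le> \<kappa> x"
  shows "ennreal (c\<^sup>2) * gravity \<rho> \<le> gravity \<kappa>"
proof -
  have \<kappa>0: "0 \<le> \<kappa> x" for x using le[of x] \<rho>0[of x] c by (meson mult_nonneg_nonneg order_trans)
  have "ennreal (c\<^sup>2) * gravity \<rho>
     = (\<integral>\<^sup>+x. \<integral>\<^sup>+y. ennreal (c\<^sup>2) * ennreal (\<rho> x * \<rho> y / norm (x - y)) \<partial>lborel \<partial>lborel)"
    using \<rho>0 by (simp add: gravity_eq nn_integral_cmult)
  also have "\<dots> \<le> (\<integral>\<^sup>+x. \<integral>\<^sup>+y. ennreal (\<kappa> x * \<kappa> y / norm (x - y)) \<partial>lborel \<partial>lborel)"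
  proof (intro nn_integral_mono)
    fix x y
    have "(c * \<rho> x) * (c * \<rho> y) / norm (x - y) \<le> \<kappa> x * \<kappa> y / norm (x - y)"
      using le \<rho>0 \<kappa>0 c by (intro divide_right_mono mult_mono) auto
    then show "ennreal (c\<^sup>2) * ennreal (\<rho> x * \<rho> y / norm (x - y)) \<le> ennreal (\<kappa> x * \<kappa> y / norm (x - y))"
      using \<rho>0 by (subst ennreal_mult[symmetric])
        (auto intro!: ennreal_leI simp: power2_eq_square algebra_simps)
  qed
  also have "\<dots> = gravity \<kappa>" using \<kappa>0 by (simp add: gravity_eq)
  finally show ?thesis .
qed

text \<open>Letting t tend to 0 in such a bound replaces differentiation of the energy along a
  segment.\<close>

lemma nonpos_if_linear_bound:
  fixes e K t0 :: real
  assumes "t0 > 0" and bound: "\<And>t. 0 < t \<Longrightarrow> t < t0 \<Longrightarrow> e \<le> t * K"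
  shows "e \<le> 0"
proof (rule tendsto_le[OF _ _ tendsto_const])
  show "((\<lambda>t. t * K) \<longlongrightarrow> 0) (at_right 0)"
    by (intro tendsto_eq_intros) auto
  show "eventually (\<lambda>t. e \<le> t * K) (at_right 0)"
    unfolding eventually_at_right_field using assms by auto
qed simp

lemma densities_gravity_finite:
  assumes "\<rho> \<in> densities" "\<And>x. 0 \<le> \<rho> x"
  obtains g where "0 \<le> g" "gravity \<rho> = ennreal g"
proof -
  have "gravity \<rho> < \<infinity>"
    using assms densities_nonneg_iff[of \<rho>] by (intro gravity_finite) auto
  then show ?thesis using that by (cases "gravity \<rho>") auto
qed

text \<open>All that is kept of the topology. The bound \<open>t0\<close> may depend on
  \<open>\<sigma>\<close>, since nothing makes neighbourhoods uniform over directions.\<close>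

definition segment_minimizer :: "((real^3 \<Rightarrow> real) \<Rightarrow> ereal) \<Rightarrow> (real^3 \<Rightarrow> real) \<Rightarrow> bool" where
  "segment_minimizer E \<rho> \<longleftrightarrow> (\<forall>\<sigma>\<in>densities. (\<forall>x. 0 \<le> \<sigma> x) \<longrightarrow>
     (\<exists>t0>0. t0 \<le> 1 \<and> (\<forall>t. 0 < t \<longrightarrow> t < t0 \<longrightarrow> E \<rho> \<le> E (\<lambda>x. (1 - t) * \<rho> x + t * \<sigma> x))))"

text \<open>Mixing in a density of infinite second moment switches the rotational energy off at
  arbitrarily small cost in the other two terms.\<close>

lemma segment_minimizer_second_moment_infinite:
  assumes P: "pressure P" "small_density_condition P" and J: "J > 0"
    and \<rho>: "\<rho> \<in> densities" "\<And>x. 0 \<le> \<rho> x"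
    and fin: "energy P J \<rho> < \<infinity>"
    and min: "segment_minimizer (energy P J) \<rho>"
  shows "(\<integral>\<^sup>+x. ennreal ((axis_dist x)\<^sup>2 * \<rho> x) \<partial>lborel) = \<infinity>"
proof (rule ccontr)
  assume m2: "(\<integral>\<^sup>+x. ennreal ((axis_dist x)\<^sup>2 * \<rho> x) \<partial>lborel) \<noteq> \<infinity>"
  have D[measurable]: "\<rho> \<in> borel_measurable borel" and mass: "(\<integral>\<^sup>+x. ennreal (\<rho> x) \<partial>lborel) = 1"
    using densities_nonneg_iff[of \<rho>] \<rho> by auto
  note [measurable] = borel_measurable_internal_density[OF P]
  have "internal_energy P \<rho> \<noteq> \<infinity>" using fin internal_energy_infinite[of P \<rho> J] by auto
  then obtain u where u: "0 \<le> u" "internal_energy P \<rho> = ennreal u"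
    by (cases "internal_energy P \<rho>") auto
  obtain g where g: "0 \<le> g" "gravity \<rho> = ennreal g" by (rule densities_gravity_finite[OF \<rho>])
  have "moment_of_inertia \<rho> < \<infinity>" by (rule moment_of_inertia_finite[OF D \<rho>(2) mass m2])
  then obtain e where e: "e > 0" "ereal (u - g / 2 + e) \<le> energy P J \<rho>"
    using energy_cases_inertia(2)[OF u(2,1) g(2,1)] J by blast
  obtain \<sigma> b where \<sigma>m[measurable]: "\<sigma> \<in> borel_measurable borel" and
    \<sigma>0: "\<And>x. 0 \<le> \<sigma> x" and \<sigma>b: "\<And>x. \<sigma> x \<le> b" and \<sigma>1: "(\<integral>\<^sup>+x. ennreal (\<sigma> x) \<partial>lborel) = 1"
    and \<sigma>2: "(\<integral>\<^sup>+x. ennreal ((axis_dist x)\<^sup>2 * \<sigma> x) \<partial>lborel) = \<infinity>"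
    by (rule bounded_density_infinite_second_moment) blast
  note \<sigma>d = densities_internal_energy_bounded[OF P \<sigma>m \<sigma>0 \<sigma>b \<sigma>1]
  obtain v where v: "0 \<le> v" "internal_energy P \<sigma> = ennreal v"
    using \<sigma>d(2) by (cases "internal_energy P \<sigma>") auto
  obtain t0 where t0: "t0 > 0" "t0 \<le> 1" "\<And>t. 0 < t \<Longrightarrow> t < t0 \<Longrightarrow>
          energy P J \<rho> \<le> energy P J (\<lambda>x. (1 - t) * \<rho> x + t * \<sigma> x)"
    using min \<sigma>d(1) \<sigma>0 unfolding segment_minimizer_def by blast
  \<comment> \<open>Here \<open>e\<close> is a lower bound for the rotational energy of
    \<open>\<rho>\<close>, which disappears for every positive t. By convexity the internal energy
    rises by at most t v, and since (1 - t)^2 is at least 1 - 2 t, half of the gravity falls by at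
    most t g.\<close>
  have "e \<le> t * (v + g)" if t: "0 < t" "t < t0" for t
  proof -
    define \<kappa> where "\<kappa> x = (1 - t) * \<rho> x + t * \<sigma> x" for x
    have \<kappa>d: "\<kappa> \<in> densities" unfolding \<kappa>_def[abs_def]
      using t t0 by (intro densities_convex \<rho> \<sigma>d \<sigma>0) auto
    have \<kappa>0: "0 \<le> \<kappa> x" for x unfolding \<kappa>_def using \<rho>(2) \<sigma>0 t t0 by simp
    have \<kappa>m[measurable]: "\<kappa> \<in> borel_measurable borel" unfolding \<kappa>_def[abs_def] by measurable
    have "internal_energy P \<kappa> \<le> (\<integral>\<^sup>+x. ennreal (1 - t) * ennreal (internal_density P (\<rho> x))
        + ennreal t * ennreal (internal_density P (\<sigma> x)) \<partial>lborel)"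
      unfolding internal_energy_def
    proof (intro nn_integral_mono)
      fix x
      have "internal_density P (\<kappa> x)
          \<le> (1 - t) * internal_density P (\<rho> x) + t * internal_density P (\<sigma> x)"
        unfolding \<kappa>_def using t t0 by (intro internal_density_convex P \<rho> \<sigma>0) auto
      then show "ennreal (internal_density P (\<kappa> x)) \<le> ennreal (1 - t) * ennreal (internal_density P (\<rho> x))
        + ennreal t * ennreal (internal_density P (\<sigma> x))"
        using t t0 internal_density_nonneg[OF P(1)]
        by (simp add: ennreal_leI flip: ennreal_mult ennreal_plus)
    qed
    also have "\<dots> = ennreal ((1 - t) * u + t * v)"
      using t t0 u v by (simp add: nn_integral_add nn_integral_cmult
          internal_energy_def[symmetric] flip: ennreal_mult ennreal_plus)
    finally have U: "internal_energy P \<kappa> \<le> ennreal ((1 - t) * u + t * v)" .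
    then obtain u' where u': "0 \<le> u'" "internal_energy P \<kappa> = ennreal u'"
      by (cases "internal_energy P \<kappa>") (auto simp: top_unique)
    have uu: "u' \<le> (1 - t) * u + t * v"
      using U u v t t0 unfolding u'(2) by (subst (asm) ennreal_le_iff) auto
    obtain g' where g': "0 \<le> g'" "gravity \<kappa> = ennreal g'"
      by (rule densities_gravity_finite[OF \<kappa>d \<kappa>0])
    have "ennreal ((1 - t)\<^sup>2) * gravity \<rho> \<le> gravity \<kappa>"
      using t t0 \<rho>(2) \<sigma>0 by (intro gravity_scaled_le) (auto simp: \<kappa>_def)
    then have gg: "(1 - t)\<^sup>2 * g \<le> g'"
      using g g' by (simp add: ennreal_le_iff flip: ennreal_mult)
    have "moment_of_inertia \<kappa> = \<infinity>"
      using \<rho>(2) \<sigma>0 t t0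
      by (intro moment_of_inertia_infinite_mono[OF \<sigma>m _ t(1) _ \<sigma>2]) (auto simp: \<kappa>_def)
    then have "energy P J \<kappa> = ereal (u' - g' / 2)" by (rule energy_cases_inertia(1)[OF u'(2,1) g'(2,1)])
    then have "u - g / 2 + e \<le> u' - g' / 2"
      using e t0(3)[OF t] by (simp add: \<kappa>_def[abs_def])
        (metis ereal_less_eq(3) order_trans)
    moreover have "g' / 2 \<ge> g / 2 - t * g"
    proof -
      have "(1 - t)\<^sup>2 * g \<ge> (1 - 2 * t) * g"
        using g by (intro mult_right_mono) (auto simp: power2_eq_square algebra_simps)
      then show ?thesis using gg by (simp add: algebra_simps)
    qed
    moreover have "u' \<le> u + t * v"
    proof -
      have "(1 - t) * u \<le> u" using u t by (simp add: mult_left_le_one_le algebra_simps)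
      then show ?thesis using uu by simp
    qed
    ultimately show ?thesis by (simp add: algebra_simps)
  qed
  then have "e \<le> 0" using nonpos_if_linear_bound[of t0 e "v + g"] t0 by blast
  then show False using e by simp
qed

lemma mass_outside_ball:
  fixes \<rho> :: "real^3 \<Rightarrow> real"
  assumes [measurable]: "\<rho> \<in> borel_measurable borel"
    and mass: "(\<integral>\<^sup>+x. ennreal (\<rho> x) \<partial>lborel) = 1" and m: "m > 0"
  obtains R where "R > 0" "(\<integral>\<^sup>+x\<in>- ball 0 R. ennreal (\<rho> x) \<partial>lborel) \<le> ennreal m"
proof -
  define A :: "nat \<Rightarrow> (real^3) set" where "A n = - ball 0 (real (Suc n))" for n
  define M where "M = density lborel (\<lambda>x. ennreal (\<rho> x))"
  have [measurable]: "A n \<in> sets borel" for n unfolding A_def by (intro borel_comp) simp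
  have M: "emeasure M (A n) = (\<integral>\<^sup>+x\<in>A n. ennreal (\<rho> x) \<partial>lborel)" for n
    unfolding M_def by (subst emeasure_density) auto
  have fin: "emeasure M (A n) \<noteq> \<infinity>" for n
  proof -
    have "(\<integral>\<^sup>+x\<in>A n. ennreal (\<rho> x) \<partial>lborel) \<le> (\<integral>\<^sup>+x. ennreal (\<rho> x) \<partial>lborel)"
      by (intro nn_integral_mono) (auto simp: indicator_def)
    then show ?thesis using mass M[of n] by (auto simp: top_unique)
  qed
  have "(\<lambda>n. emeasure M (A n)) \<longlonglongrightarrow> emeasure M (\<Inter>n. A n)"
  proof (rule Lim_emeasure_decseq)
    show "range A \<subseteq> sets M" by (auto simp: M_def)
    show "decseq A" by (auto simp: A_def decseq_def)
  qed (rule fin)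
  moreover have "(\<Inter>n. A n) = {}"
  proof -
    have "x \<notin> (\<Inter>n. A n)" for x
    proof -
      obtain n where "norm x < real n" using reals_Archimedean2 by blast
      then have "x \<notin> A n" by (simp add: A_def)
      then show ?thesis by blast
    qed
    then show ?thesis by blast
  qed
  ultimately have "(\<lambda>n. emeasure M (A n)) \<longlonglongrightarrow> 0" by simp
  then have "eventually (\<lambda>n. emeasure M (A n) < ennreal m) sequentially"
    using m by (intro order_tendstoD(2)) auto
  then obtain n where "emeasure M (A n) < ennreal m" by (auto simp: eventually_sequentially)
  then show ?thesis using that[of "real (Suc n)"] M[of n] by (simp add: A_def less_imp_le)
qed

section \<open>Gravitational gain of a displaced mass\<close>

text \<open>At least half of the mass lies in the ball of radius \<open>R0\<close>, and for R at
  least \<open>R0\<close> it has distance at most 2 R from every point of the ball of radius R; the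
  bound is 1/2 times 1/(2 R).\<close>

lemma potential_ge_on_ball:
  fixes \<rho> :: "real^3 \<Rightarrow> real"
  assumes [measurable]: "\<rho> \<in> borel_measurable borel" and \<rho>0: "\<And>x. 0 \<le> \<rho> x"
    and mass: "(\<integral>\<^sup>+x. ennreal (\<rho> x) \<partial>lborel) = 1"
  obtains R0 where "R0 > 0"
    "\<And>R x. R0 \<le> R \<Longrightarrow> x \<in> ball 0 R \<Longrightarrow> ennreal (1 / (4 * R)) \<le> potential \<rho> x"
proof -
  obtain R0 where R0: "R0 > 0" "(\<integral>\<^sup>+x\<in>- ball 0 R0. ennreal (\<rho> x) \<partial>lborel) \<le> ennreal (1/2)"
    using mass_outside_ball[OF assms(1) mass, of "1/2"] by auto
  have [measurable]: "ball (0::real^3) R0 \<in> sets borel" by simp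
  have half: "ennreal (1/2) \<le> (\<integral>\<^sup>+x\<in>ball 0 R0. ennreal (\<rho> x) \<partial>lborel)"
  proof -
    have "1 = (\<integral>\<^sup>+x. ennreal (\<rho> x) * indicator (ball 0 R0) x
        + ennreal (\<rho> x) * indicator (- ball 0 R0) x \<partial>lborel)"
      unfolding mass[symmetric] by (intro nn_integral_cong) (auto simp: indicator_def)
    also have "\<dots> = (\<integral>\<^sup>+x\<in>ball 0 R0. ennreal (\<rho> x) \<partial>lborel)
        + (\<integral>\<^sup>+x\<in>- ball 0 R0. ennreal (\<rho> x) \<partial>lborel)"
      by (rule nn_integral_add) measurable
    finally have sum: "1 = (\<integral>\<^sup>+x\<in>ball 0 R0. ennreal (\<rho> x) \<partial>lborel)
        + (\<integral>\<^sup>+x\<in>- ball 0 R0. ennreal (\<rho> x) \<partial>lborel)" .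
    have le: "1 \<le> (\<integral>\<^sup>+x\<in>ball 0 R0. ennreal (\<rho> x) \<partial>lborel) + ennreal (1/2)"
      by (subst sum) (intro add_left_mono R0)
    show ?thesis
    proof (cases "\<integral>\<^sup>+x\<in>ball 0 R0. ennreal (\<rho> x) \<partial>lborel")
      case (real r)
      have "ennreal 1 \<le> ennreal (r + 1/2)"
        using le real(1) unfolding real(2) by (subst ennreal_plus) auto
      then have "1 \<le> r + 1/2" using real(1) by (subst (asm) ennreal_le_iff) auto
      then show ?thesis unfolding real(2) by (intro ennreal_leI) simp
    qed simp
  qed
  show ?thesis
  proof
    fix R :: real and x :: "real^3" assume R: "R0 \<le> R" and x: "x \<in> ball 0 R"
    have "ennreal (1 / (4 * R)) = ennreal (1 / (2 * R)) * ennreal (1/2)"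
      using R R0 by (subst ennreal_mult[symmetric]) auto
    also have "\<dots> \<le> ennreal (1 / (2 * R)) * (\<integral>\<^sup>+y\<in>ball 0 R0. ennreal (\<rho> y) \<partial>lborel)"
      by (intro mult_left_mono half) simp
    also have "\<dots> = (\<integral>\<^sup>+y. ennreal (1 / (2 * R)) * (ennreal (\<rho> y) * indicator (ball 0 R0) y) \<partial>lborel)"
      by (rule nn_integral_cmult[symmetric]) measurable
    also have "\<dots> \<le> potential \<rho> x"
      unfolding potential_def
    proof (intro nn_integral_mono_AE)
      \<comment> \<open>At y = x the quotient is 0 by convention, and the lower bound could
        fail.\<close>
      have "AE y in lborel. y \<noteq> x" by (rule AE_lborel_singleton)
      then show "AE y in lborel. ennreal (1 / (2 * R)) * (ennreal (\<rho> y) * indicator (ball 0 R0) y)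
          \<le> ennreal (\<rho> y / norm (x - y))"
      proof eventually_elim
        fix y assume y: "y \<noteq> x"
        show "ennreal (1 / (2 * R)) * (ennreal (\<rho> y) * indicator (ball 0 R0) y)
          \<le> ennreal (\<rho> y / norm (x - y))"
        proof (cases "y \<in> ball 0 R0")
          case True
          have "norm (x - y) \<le> norm x + norm y" by (rule norm_triangle_ineq4)
          also have "\<dots> \<le> 2 * R" using x True R by simp
          finally have "\<rho> y / (2 * R) \<le> \<rho> y / norm (x - y)"
            using y \<rho>0[of y] R R0 by (intro divide_left_mono mult_pos_pos) auto
          then show ?thesis using True \<rho>0[of y] R R0
            by (simp add: ennreal_leI flip: ennreal_mult)
        qed simp
      qed
    qed
    finally show "ennreal (1 / (4 * R)) \<le> potential \<rho> x" .
  qed (fact R0(1))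
qed

text \<open>By (F2) the cost of matter at density of order \<open>c0 ^ 3\<close> is \<open>o(c0)\<close>. With \<open>c0\<close> a large
  multiple of \<open>1/R\<close> a ball of radius \<open>R\<close> cannot be filled to that density by unit mass, while
  its potential is at least of order \<open>1/R\<close>.\<close>

lemma favourable_set:
  fixes \<rho> :: "real^3 \<Rightarrow> real"
  assumes P: "pressure P" "small_density_condition P"
    and \<rho>[measurable]: "\<rho> \<in> borel_measurable borel" and \<rho>0: "\<And>x. 0 \<le> \<rho> x"
    and mass: "(\<integral>\<^sup>+x. ennreal (\<rho> x) \<partial>lborel) = 1"
  obtains S a \<Lambda> \<epsilon> where "S \<in> sets borel" "0 < emeasure lborel S" "emeasure lborel S < \<infinity>"
    "0 < a" "0 \<le> \<Lambda>" "0 < \<epsilon>" "\<And>x. x \<in> S \<Longrightarrow> \<rho> x \<le> a"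
    "\<And>x. x \<in> S \<Longrightarrow> ennreal (\<Lambda> + \<epsilon>) \<le> potential \<rho> x"
    "\<And>s d. 0 \<le> s \<Longrightarrow> s \<le> a \<Longrightarrow> 0 \<le> d \<Longrightarrow> d \<le> a \<Longrightarrow>
       internal_density P (s + d) \<le> internal_density P s + d * \<Lambda>"
proof -
  obtain R0 where R0: "R0 > 0"
    "\<And>R x. R0 \<le> R \<Longrightarrow> x \<in> ball 0 R \<Longrightarrow> ennreal (1 / (4 * R)) \<le> potential \<rho> x"
    by (rule potential_ge_on_ball[OF \<rho> \<rho>0 mass]) blast
  define \<kappa> where "\<kappa> = unit_ball_vol (real CARD(3))"
  have \<kappa>: "\<kappa> > 0" unfolding \<kappa>_def by simp
  \<comment> \<open>With \<open>c0\<close> and \<open>a\<close> as below, a ball of radius R filled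
    to density \<open>a\<close> has mass \<kappa> / (65536 \<eta>^3). Since \<eta> is at most 1, the
    bound \<kappa> / 131072 also holds for \<eta>^3 and forces this mass to be at least 2.\<close>
  define \<eta> where "\<eta> = min 1 (\<kappa> / 131072)"
  have \<eta>: "0 < \<eta>" "\<eta> \<le> 1" "\<eta> \<le> \<kappa> / 131072" using \<kappa> by (auto simp: \<eta>_def)
  obtain s0 where s0: "s0 > 0" "\<And>s. 0 < s \<Longrightarrow> s \<le> s0 \<Longrightarrow> P s \<le> \<eta> * s powr (4/3)"
    by (rule small_density_bound[OF P(2) \<eta>(1)]) blast
  \<comment> \<open>The second entry makes R large enough for \<open>c0^3\<close> to lie in the
    range below \<open>s0\<close>, where the estimate from (F2) holds.\<close>
  define R where "R = max R0 (1 / (32 * \<eta> * s0 powr (1/3)))"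
  have R: "R0 \<le> R" "R > 0" using R0 by (auto simp: R_def)
  \<comment> \<open>Chosen so that the marginal cost 4 \<eta> c0 at density c0^3 equals 1/(8 R),
    half of the lower bound 1/(4 R) for the potential. The other half is the net gain.\<close>
  define c0 where "c0 = 1 / (32 * \<eta> * R)"
  have c0: "c0 > 0" using R \<eta> by (simp add: c0_def)
  have root: "(c0^3) powr (1/3) = c0"
    using c0 powr_powr[of c0 3 "1/3"] by (simp add: powr_numeral)
  have "1 / (32 * \<eta> * s0 powr (1/3)) \<le> R" by (simp add: R_def)
  then have "c0 \<le> s0 powr (1/3)"
    using \<eta> R s0 by (simp add: c0_def field_simps)
  then have "c0^3 \<le> (s0 powr (1/3))^3" using c0 by (intro power_mono) auto
  also have "\<dots> = (s0 powr (1/3)) powr 3" using s0 by simp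
  also have "\<dots> = s0" using s0 unfolding powr_powr by simp
  finally have c0s0: "c0^3 \<le> s0" .
  \<comment> \<open>Half of c0^3: a density at most \<open>a\<close>, increased by at most
    \<open>a\<close>, stays within the range of the slope bound.\<close>
  define a where "a = c0^3 / 2"
  have a: "a > 0" using c0 by (simp add: a_def)
  define S where "S = {x \<in> ball 0 R. \<rho> x < a}"
  show ?thesis
  proof
    show S[measurable]: "S \<in> sets borel" unfolding S_def by measurable
    have ball: "emeasure lborel (ball (0::real^3) R) = ennreal (\<kappa> * R^3)"
      using R by (simp add: emeasure_ball \<kappa>_def)
    have "emeasure lborel S \<le> emeasure lborel (ball (0::real^3) R)"
      by (intro emeasure_mono) (auto simp: S_def)
    then show "emeasure lborel S < \<infinity>" using ball by (simp add: le_less_trans)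
    show "0 < a" by fact
    show "(0::real) \<le> 1 / (8 * R)" "0 < 1 / (8 * R)" using R by auto
    show "\<rho> x \<le> a" if "x \<in> S" for x using that by (simp add: S_def)
    show "ennreal (1 / (8 * R) + 1 / (8 * R)) \<le> potential \<rho> x" if "x \<in> S" for x
    proof -
      have "1 / (8 * R) + 1 / (8 * R) = 1 / (4 * R)" by (simp add: field_simps)
      then show ?thesis using R0(2)[OF R(1), of x] that by (simp add: S_def)
    qed
    show "internal_density P (s + d) \<le> internal_density P s + d * (1 / (8 * R))"
      if "0 \<le> s" "s \<le> a" "0 \<le> d" "d \<le> a" for s d
    proof -
      have "internal_density P (s + d) \<le> internal_density P s + d * (4 * \<eta> * (c0^3) powr (1/3))"
        using that \<eta> c0s0 s0 by (intro internal_density_slope_bound P) (auto simp: a_def)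
      also have "4 * \<eta> * (c0^3) powr (1/3) = 1 / (8 * R)"
        unfolding root using \<eta> R by (simp add: c0_def)
      finally show ?thesis .
    qed
    \<comment> \<open>If S were a null set, rho would be at least \<open>a\<close> almost everywhere
      in the ball, which by the choice of \<eta> needs more than unit mass.\<close>
    show "0 < emeasure lborel S"
    proof (rule ccontr)
      assume "\<not> 0 < emeasure lborel S"
      then have "emeasure lborel S = 0" by simp
      then have "AE x in lborel. x \<notin> S" by (intro AE_not_in) auto
      then have "AE x in lborel. ennreal a * indicator (ball (0::real^3) R) x \<le> ennreal (\<rho> x)"
        by eventually_elim (auto simp: S_def indicator_def intro!: ennreal_leI)
      then have "(\<integral>\<^sup>+x. ennreal a * indicator (ball (0::real^3) R) x \<partial>lborel) \<le> (\<integral>\<^sup>+x. ennreal (\<rho> x) \<partial>lborel)"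
        by (rule nn_integral_mono_AE)
      then have "ennreal (a * (\<kappa> * R^3)) \<le> ennreal 1"
        using mass a \<kappa> R by (simp add: nn_integral_cmult_indicator ball ennreal_mult)
      then have "a * (\<kappa> * R^3) \<le> 1" by (simp add: ennreal_le_iff del: ennreal_1)
      moreover have "a * (\<kappa> * R^3) = \<kappa> / (65536 * \<eta>^3)"
        using R \<eta> by (simp add: a_def c0_def field_simps power3_eq_cube)
      moreover have "\<eta>^3 \<le> \<kappa> / 131072"
      proof -
        have "\<eta>^3 \<le> \<eta>^1" using \<eta> by (intro power_decreasing) auto
        then show ?thesis using \<eta> by simp
      qed
      moreover have "\<eta>^3 > 0" using \<eta> by simp
      ultimately have "\<kappa> \<le> 65536 * \<eta>^3" by (simp add: field_simps)
      then show False using \<open>\<eta>^3 \<le> \<kappa> / 131072\<close> \<kappa> by simp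
    qed
  qed
qed

section \<open>The symmetric form behind the gravitational energy\<close>

lemma nn_integral_pair_swap:
  fixes f g :: "real^3 \<Rightarrow> real"
  assumes [measurable]: "f \<in> borel_measurable borel" "g \<in> borel_measurable borel"
  shows "(\<integral>\<^sup>+x. \<integral>\<^sup>+y. ennreal (f x * g y / norm (x - y)) \<partial>lborel \<partial>lborel)
    = (\<integral>\<^sup>+x. \<integral>\<^sup>+y. ennreal (g x * f y / norm (x - y)) \<partial>lborel \<partial>lborel)"
proof -
  have "(\<integral>\<^sup>+x. \<integral>\<^sup>+y. ennreal (f x * g y / norm (x - y)) \<partial>lborel \<partial>lborel)
     = (\<integral>\<^sup>+y. \<integral>\<^sup>+x. ennreal (f x * g y / norm (x - y)) \<partial>lborel \<partial>lborel)"
    by (rule lborel_pair.Fubini') measurable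
  then show ?thesis by (simp add: norm_minus_commute mult.commute)
qed

text \<open>The Newtonian bilinear form, whose diagonal on nonnegative functions is
  \<open>gravity\<close>.\<close>

definition pairing :: "(real^3 \<Rightarrow> real) \<Rightarrow> (real^3 \<Rightarrow> real) \<Rightarrow> ennreal" where
  "pairing f g = (\<integral>\<^sup>+x. \<integral>\<^sup>+y. ennreal (f x * g y / norm (x - y)) \<partial>lborel \<partial>lborel)"

lemma pairing_eq_potential:
  assumes [measurable]: "f \<in> borel_measurable borel" "g \<in> borel_measurable borel"
    and "\<And>x. 0 \<le> f x"  "\<And>x. 0 \<le> g x"
  shows "pairing f g = (\<integral>\<^sup>+x. ennreal (f x) * potential g x \<partial>lborel)"
  unfolding pairing_def potential_def
proof (intro nn_integral_cong)
  fix x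
  have "ennreal (f x) * (\<integral>\<^sup>+y. ennreal (g y / norm (x - y)) \<partial>lborel)
     = (\<integral>\<^sup>+y. ennreal (f x) * ennreal (g y / norm (x - y)) \<partial>lborel)"
    by (simp add: nn_integral_cmult)
  also have "\<dots> = (\<integral>\<^sup>+y. ennreal (f x * g y / norm (x - y)) \<partial>lborel)"
    using assms by (intro nn_integral_cong) (simp flip: ennreal_mult)
  finally show "(\<integral>\<^sup>+y. ennreal (f x * g y / norm (x - y)) \<partial>lborel)
     = ennreal (f x) * (\<integral>\<^sup>+y. ennreal (g y / norm (x - y)) \<partial>lborel)" by simp
qed

text \<open>First-order expansion of the quadratic form, arranged without subtraction because the
  values are in \<open>ennreal\<close>: the loss from removing \<open>t * v x * \<rho> x\<close>
  stands on the right. The only harmful second-order terms pair f with v rho; as v is at most 1, the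
  last summand covers them.\<close>

lemma gravity_perturbation:
  fixes \<rho> f v :: "real^3 \<Rightarrow> real"
  assumes [measurable]: "\<rho> \<in> borel_measurable borel" "f \<in> borel_measurable borel" "v \<in> borel_measurable borel"
    and \<rho>0: "\<And>x. 0 \<le> \<rho> x" and f0: "\<And>x. 0 \<le> f x" and v: "\<And>x. 0 \<le> v x" "\<And>x. v x \<le> 1"
    and t: "0 \<le> t" "t \<le> 1"
  shows "gravity \<rho> + ennreal (2 * t) * pairing f \<rho>
    \<le> gravity (\<lambda>x. (1 - t * v x) * \<rho> x + t * f x) + ennreal (2 * t) * pairing (\<lambda>x. v x * \<rho> x) \<rho>
      + ennreal (2 * t\<^sup>2) * pairing f \<rho>"
proof -
  let ?k = "\<lambda>x y :: real^3. norm (x - y)"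
  define \<kappa> where "\<kappa> x = (1 - t * v x) * \<rho> x + t * f x" for x
  have [measurable]: "\<kappa> \<in> borel_measurable borel" unfolding \<kappa>_def[abs_def] by measurable
  have tv: "t * v x \<le> 1" for x using mult_mono[of t 1 "v x" 1] t v by simp
  have \<kappa>0: "0 \<le> \<kappa> x" for x unfolding \<kappa>_def using \<rho>0 f0 t tv by simp
  have "gravity \<rho> + ennreal (2 * t) * pairing f \<rho>
     = gravity \<rho> + (ennreal t * pairing f \<rho> + ennreal t * pairing \<rho> f)"
  proof -
    have "pairing \<rho> f = pairing f \<rho>" unfolding pairing_def by (rule nn_integral_pair_swap) measurable
    moreover have "ennreal (2 * t) = ennreal t + ennreal t" using t by (simp flip: ennreal_plus)
    ultimately show ?thesis by (simp add: distrib_right)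
  qed
  also have "\<dots> = (\<integral>\<^sup>+x. \<integral>\<^sup>+y. ennreal (\<rho> x * \<rho> y / ?k x y)
      + (ennreal t * ennreal (f x * \<rho> y / ?k x y) + ennreal t * ennreal (\<rho> x * f y / ?k x y)) \<partial>lborel \<partial>lborel)"
    using \<rho>0 by (simp add: gravity_eq pairing_def nn_integral_add nn_integral_cmult)
  also have "\<dots> \<le> (\<integral>\<^sup>+x. \<integral>\<^sup>+y. ennreal (\<kappa> x * \<kappa> y / ?k x y)
      + (ennreal t * ennreal (v x * \<rho> x * \<rho> y / ?k x y) + ennreal t * ennreal (\<rho> x * (v y * \<rho> y) / ?k x y))
      + (ennreal (t\<^sup>2) * ennreal (f x * \<rho> y / ?k x y) + ennreal (t\<^sup>2) * ennreal (\<rho> x * f y / ?k x y))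
       \<partial>lborel \<partial>lborel)"
  proof (intro nn_integral_mono)
    fix x y
    let ?L = "\<rho> x * \<rho> y + (t * (f x * \<rho> y) + t * (\<rho> x * f y))"
    let ?R = "\<kappa> x * \<kappa> y + (t * (v x * \<rho> x * \<rho> y) + t * (\<rho> x * (v y * \<rho> y)))
         + (t\<^sup>2 * (f x * \<rho> y) + t\<^sup>2 * (\<rho> x * f y))"
    have "?R - ?L = t\<^sup>2 * (v x * \<rho> x * (v y * \<rho> y)) + t\<^sup>2 * (f x * f y)
        + t\<^sup>2 * (f x * \<rho> y * (1 - v y)) + t\<^sup>2 * (\<rho> x * f y * (1 - v x))"
      unfolding \<kappa>_def by (simp add: algebra_simps power2_eq_square)
    also have "\<dots> \<ge> 0" using \<rho>0 f0 v by (intro add_nonneg_nonneg mult_nonneg_nonneg) auto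
    finally have "?L / ?k x y \<le> ?R / ?k x y" by (intro divide_right_mono) auto
    then have le: "\<rho> x * \<rho> y / ?k x y + (t * (f x * \<rho> y / ?k x y) + t * (\<rho> x * f y / ?k x y))
       \<le> \<kappa> x * \<kappa> y / ?k x y + (t * (v x * \<rho> x * \<rho> y / ?k x y) + t * (\<rho> x * (v y * \<rho> y) / ?k x y))
         + (t\<^sup>2 * (f x * \<rho> y / ?k x y) + t\<^sup>2 * (\<rho> x * f y / ?k x y))"
      by (simp only: add_divide_distrib times_divide_eq_right)
    have nn: "0 \<le> \<rho> x * \<rho> y / ?k x y" "0 \<le> f x * \<rho> y / ?k x y" "0 \<le> \<rho> x * f y / ?k x y"
      "0 \<le> \<kappa> x * \<kappa> y / ?k x y" "0 \<le> v x * \<rho> x * \<rho> y / ?k x y" "0 \<le> \<rho> x * (v y * \<rho> y) / ?k x y" "0 \<le> t\<^sup>2"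
      using \<rho>0 f0 v \<kappa>0 by (auto intro!: divide_nonneg_nonneg mult_nonneg_nonneg)
    show "ennreal (\<rho> x * \<rho> y / ?k x y)
      + (ennreal t * ennreal (f x * \<rho> y / ?k x y) + ennreal t * ennreal (\<rho> x * f y / ?k x y))
      \<le> ennreal (\<kappa> x * \<kappa> y / ?k x y)
      + (ennreal t * ennreal (v x * \<rho> x * \<rho> y / ?k x y) + ennreal t * ennreal (\<rho> x * (v y * \<rho> y) / ?k x y))
      + (ennreal (t\<^sup>2) * ennreal (f x * \<rho> y / ?k x y) + ennreal (t\<^sup>2) * ennreal (\<rho> x * f y / ?k x y))"
      using ennreal_leI[OF le] nn t
      by (simp only: ennreal_mult ennreal_plus mult_nonneg_nonneg add_nonneg_nonneg)
  qed
  also have "\<dots> = gravity \<kappa> + (ennreal t * pairing (\<lambda>x. v x * \<rho> x) \<rho> + ennreal t * pairing \<rho> (\<lambda>x. v x * \<rho> x))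
      + (ennreal (t\<^sup>2) * pairing f \<rho> + ennreal (t\<^sup>2) * pairing \<rho> f)"
    using \<kappa>0 by (simp add: gravity_eq pairing_def nn_integral_add nn_integral_cmult)
  also have "\<dots> = gravity \<kappa> + ennreal (2 * t) * pairing (\<lambda>x. v x * \<rho> x) \<rho>
      + ennreal (2 * t\<^sup>2) * pairing f \<rho>"
  proof -
    have "pairing \<rho> f = pairing f \<rho>" "pairing \<rho> (\<lambda>x. v x * \<rho> x) = pairing (\<lambda>x. v x * \<rho> x) \<rho>"
      unfolding pairing_def by (rule nn_integral_pair_swap; measurable)+
    moreover have "ennreal (2 * t) = ennreal t + ennreal t" "ennreal (2 * t\<^sup>2) = ennreal (t\<^sup>2) + ennreal (t\<^sup>2)"
      using t by (simp_all flip: ennreal_plus)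
    ultimately show ?thesis by (simp add: distrib_right)
  qed
  finally show ?thesis unfolding \<kappa>_def[abs_def] .
qed

section \<open>Minimizers with infinite second moment\<close>

text \<open>First variation along the segment towards \<open>(1 - v) \<rho> + \<theta> 1\<^sub>S / |S|\<close>, which moves the mass
  \<open>v \<rho>\<close> to a favourable set \<open>S\<close>. The moment of inertia stays infinite along it.\<close>

lemma segment_minimizer_variational_inequality:
  assumes P: "pressure P" "small_density_condition P"
    and \<rho>: "\<rho> \<in> densities" "\<And>x. 0 \<le> \<rho> x"
    and fin: "energy P J \<rho> < \<infinity>"
    and min: "segment_minimizer (energy P J) \<rho>"
    and m2: "(\<integral>\<^sup>+x. ennreal ((axis_dist x)\<^sup>2 * \<rho> x) \<partial>lborel) = \<infinity>"
  shows "\<exists>\<epsilon>>0. \<forall>v. v \<in> borel_measurable borel \<longrightarrow> (\<forall>x. 0 \<le> v x) \<longrightarrow> (\<forall>x. v x \<le> 1) \<longrightarrow>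
      (\<integral>\<^sup>+x. ennreal (v x * internal_density P (\<rho> x)) \<partial>lborel)
        + ennreal \<epsilon> * (\<integral>\<^sup>+x. ennreal (v x * \<rho> x) \<partial>lborel)
      \<le> (\<integral>\<^sup>+x. ennreal (v x * \<rho> x) * potential \<rho> x \<partial>lborel)"
proof -
  have D[measurable]: "\<rho> \<in> borel_measurable borel" and mass: "(\<integral>\<^sup>+x. ennreal (\<rho> x) \<partial>lborel) = 1"
    using densities_nonneg_iff[of \<rho>] \<rho> by auto
  note [measurable] = borel_measurable_internal_density[OF P]
  have "internal_energy P \<rho> \<noteq> \<infinity>" using fin internal_energy_infinite[of P \<rho> J] by auto
  then obtain u where u: "0 \<le> u" "internal_energy P \<rho> = ennreal u"
    by (cases "internal_energy P \<rho>") auto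
  obtain g where g: "0 \<le> g" "gravity \<rho> = ennreal g" by (rule densities_gravity_finite[OF \<rho>])
  obtain S a \<Lambda> \<epsilon> where S[measurable]: "S \<in> sets borel" and S0: "0 < emeasure lborel S" "emeasure lborel S < \<infinity>"
    and a: "0 < a" "0 \<le> \<Lambda>" "0 < \<epsilon>" and Sa: "\<And>x. x \<in> S \<Longrightarrow> \<rho> x \<le> a"
    and SV: "\<And>x. x \<in> S \<Longrightarrow> ennreal (\<Lambda> + \<epsilon>) \<le> potential \<rho> x"
    and slope: "\<And>s d. 0 \<le> s \<Longrightarrow> s \<le> a \<Longrightarrow> 0 \<le> d \<Longrightarrow> d \<le> a \<Longrightarrow>
       internal_density P (s + d) \<le> internal_density P s + d * \<Lambda>"
    by (rule favourable_set[OF P D \<rho>(2) mass]) blast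
  obtain sz where sz: "sz > 0" "emeasure lborel S = ennreal sz"
    using S0 by (cases "emeasure lborel S") auto
  define \<sigma>0 where "\<sigma>0 x = indicator S x / sz" for x
  have \<sigma>0m[measurable]: "\<sigma>0 \<in> borel_measurable borel" unfolding \<sigma>0_def[abs_def] by measurable
  have \<sigma>00: "0 \<le> \<sigma>0 x" and \<sigma>0b: "\<sigma>0 x \<le> 1 / sz" for x
    using sz by (auto simp: \<sigma>0_def indicator_def)
  have \<sigma>01: "(\<integral>\<^sup>+x. ennreal (\<sigma>0 x) \<partial>lborel) = 1"
  proof -
    have "(\<integral>\<^sup>+x. ennreal (\<sigma>0 x) \<partial>lborel) = (\<integral>\<^sup>+x. ennreal (1 / sz) * indicator S x \<partial>lborel)"
      by (intro nn_integral_cong) (auto simp: \<sigma>0_def indicator_def)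
    also have "\<dots> = 1" using sz
      by (simp add: nn_integral_cmult_indicator flip: ennreal_mult)
    finally show ?thesis .
  qed
  note \<sigma>0d = densities_internal_energy_bounded(1)[OF P \<sigma>0m \<sigma>00 \<sigma>0b \<sigma>01]
  \<comment> \<open>A density for which both \<open>\<rho>\<close> and \<open>\<sigma>0\<close> are
    at most 2 \<tau>. It serves as a common majorant, giving the 4/3-integrability of the competitor
    and, through its finite gravity, the finiteness of \<open>pairing f \<rho>\<close>.\<close>
  define \<tau> where "\<tau> x = (1 - 1/2) * \<rho> x + 1/2 * \<sigma>0 x" for x
  have \<tau>d: "\<tau> \<in> densities" unfolding \<tau>_def[abs_def]
    by (intro densities_convex \<rho> \<sigma>0d \<sigma>00) auto
  have \<tau>0: "0 \<le> \<tau> x" for x unfolding \<tau>_def using \<rho>(2) \<sigma>00 by simp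
  have \<tau>m[measurable]: "\<tau> \<in> borel_measurable borel" unfolding \<tau>_def[abs_def] by measurable
  have "(\<integral>\<^sup>+x. ennreal (v x * internal_density P (\<rho> x)) \<partial>lborel)
        + ennreal \<epsilon> * (\<integral>\<^sup>+x. ennreal (v x * \<rho> x) \<partial>lborel)
      \<le> (\<integral>\<^sup>+x. ennreal (v x * \<rho> x) * potential \<rho> x \<partial>lborel)"
    if [measurable]: "v \<in> borel_measurable borel" and v: "\<And>x. 0 \<le> v x" "\<And>x. v x \<le> 1" for v
  proof -
    have vle: "v x * \<rho> x \<le> \<rho> x" for x using v \<rho>(2) by (simp add: mult_left_le_one_le)
    have "(\<integral>\<^sup>+x. ennreal (v x * \<rho> x) \<partial>lborel) \<le> 1"
      unfolding mass[symmetric] by (intro nn_integral_mono ennreal_leI vle)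
    then obtain \<theta> where \<theta>: "0 \<le> \<theta>" "\<theta> \<le> 1" "(\<integral>\<^sup>+x. ennreal (v x * \<rho> x) \<partial>lborel) = ennreal \<theta>"
      by (cases "\<integral>\<^sup>+x. ennreal (v x * \<rho> x) \<partial>lborel") (auto simp: top_unique)
    define f where "f x = \<theta> * \<sigma>0 x" for x
    have [measurable]: "f \<in> borel_measurable borel" unfolding f_def[abs_def] by measurable
    have f0: "0 \<le> f x" and f\<sigma>: "f x \<le> \<sigma>0 x" for x
      using \<theta> \<sigma>00 by (auto simp: f_def mult_left_le_one_le)
    have f1: "(\<integral>\<^sup>+x. ennreal (f x) \<partial>lborel) = ennreal \<theta>"
      using \<theta> \<sigma>00 \<sigma>01 by (simp add: f_def ennreal_mult nn_integral_cmult)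
    define \<sigma> where "\<sigma> x = (1 - v x) * \<rho> x + f x" for x
    have [measurable]: "\<sigma> \<in> borel_measurable borel" unfolding \<sigma>_def[abs_def] by measurable
    have \<sigma>nn: "0 \<le> \<sigma> x" for x unfolding \<sigma>_def using v \<rho>(2) f0 by simp
    have \<sigma>d: "\<sigma> \<in> densities"
    proof -
      have "(\<integral>\<^sup>+x. ennreal (\<sigma> x powr (4/3)) \<partial>lborel)
          \<le> (\<integral>\<^sup>+x. ennreal (2 powr (4/3)) * ennreal (\<tau> x powr (4/3)) \<partial>lborel)"
      proof (intro nn_integral_mono)
        fix x
        have "(1 - v x) * \<rho> x \<le> \<rho> x" using v \<rho>(2) by (simp add: mult_left_le_one_le)
        then have "\<sigma> x \<le> 2 * \<tau> x" using f\<sigma>[of x] by (simp add: \<sigma>_def \<tau>_def)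
        then have "\<sigma> x powr (4/3) \<le> (2 * \<tau> x) powr (4/3)" using \<sigma>nn by (intro powr_mono2) auto
        also have "\<dots> = 2 powr (4/3) * \<tau> x powr (4/3)" using \<tau>0 by (simp add: powr_mult)
        finally show "ennreal (\<sigma> x powr (4/3)) \<le> ennreal (2 powr (4/3)) * ennreal (\<tau> x powr (4/3))"
          by (simp add: ennreal_leI flip: ennreal_mult)
      qed
      also have "\<dots> < \<infinity>"
        using \<tau>d \<tau>0 densities_nonneg_iff[of \<tau>]
        by (simp add: nn_integral_cmult ennreal_mult_less_top less_top)
      finally have pow: "(\<integral>\<^sup>+x. ennreal (\<sigma> x powr (4/3)) \<partial>lborel) < \<infinity>" .
      have "(\<integral>\<^sup>+x. ennreal (\<sigma> x) \<partial>lborel)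
          = (\<integral>\<^sup>+x. ennreal ((1 - v x) * \<rho> x) + ennreal (f x) \<partial>lborel)"
        unfolding \<sigma>_def using v \<rho>(2) f0 by (intro nn_integral_cong ennreal_plus) auto
      also have "\<dots> = (\<integral>\<^sup>+x. ennreal ((1 - v x) * \<rho> x) \<partial>lborel) + (\<integral>\<^sup>+x. ennreal (v x * \<rho> x) \<partial>lborel)"
        by (simp add: nn_integral_add f1 \<theta>)
      also have "\<dots> = (\<integral>\<^sup>+x. ennreal ((1 - v x) * \<rho> x) + ennreal (v x * \<rho> x) \<partial>lborel)"
        by (rule nn_integral_add[symmetric]) measurable
      also have "\<dots> = (\<integral>\<^sup>+x. ennreal (\<rho> x) \<partial>lborel)"
      proof (intro nn_integral_cong)
        fix x
        have "ennreal ((1 - v x) * \<rho> x) + ennreal (v x * \<rho> x) = ennreal ((1 - v x) * \<rho> x + v x * \<rho> x)"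
          using v \<rho>(2) by (intro ennreal_plus[symmetric]) auto
        then show "ennreal ((1 - v x) * \<rho> x) + ennreal (v x * \<rho> x) = ennreal (\<rho> x)"
          by (simp add: left_diff_distrib)
      qed
      finally show ?thesis using pow mass \<sigma>nn by (subst densities_nonneg_iff) auto
    qed
    obtain g\<tau> where g\<tau>: "0 \<le> g\<tau>" "gravity \<tau> = ennreal g\<tau>"
      by (rule densities_gravity_finite[OF \<tau>d \<tau>0])
    have "pairing f \<rho> \<le> (\<integral>\<^sup>+x. \<integral>\<^sup>+y. ennreal 4 * ennreal (\<tau> x * \<tau> y / norm (x - y)) \<partial>lborel \<partial>lborel)"
      unfolding pairing_def
    proof (intro nn_integral_mono)
      fix x y
      have "f x * \<rho> y \<le> (2 * \<tau> x) * (2 * \<tau> y)"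
        using f\<sigma>[of x] \<rho>(2) \<sigma>00 f0 add_increasing[OF \<rho>(2)[of x] f\<sigma>[of x]]
        by (intro mult_mono) (auto simp: \<tau>_def)
      then have "f x * \<rho> y / norm (x - y) \<le> (2 * \<tau> x) * (2 * \<tau> y) / norm (x - y)"
        by (intro divide_right_mono) auto
      then show "ennreal (f x * \<rho> y / norm (x - y)) \<le> ennreal 4 * ennreal (\<tau> x * \<tau> y / norm (x - y))"
        using \<tau>0 by (subst ennreal_mult[symmetric]) (auto intro!: ennreal_leI)
    qed
    also have "\<dots> = ennreal (4 * g\<tau>)"
      using \<tau>0 g\<tau> by (simp add: nn_integral_cmult gravity_eq[symmetric] ennreal_mult)
    finally obtain p where p: "0 \<le> p" "pairing f \<rho> = ennreal p"
      by (cases "pairing f \<rho>") (auto simp: top_unique)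
    have "pairing (\<lambda>x. v x * \<rho> x) \<rho> \<le> gravity \<rho>"
      unfolding pairing_def gravity_eq[OF D \<rho>(2)]
      by (intro nn_integral_mono ennreal_leI divide_right_mono mult_right_mono vle \<rho>(2)) auto
    then obtain q where q: "0 \<le> q" "pairing (\<lambda>x. v x * \<rho> x) \<rho> = ennreal q"
      using g by (cases "pairing (\<lambda>x. v x * \<rho> x) \<rho>") (auto simp: top_unique)
    have "(\<integral>\<^sup>+x. ennreal (v x * internal_density P (\<rho> x)) \<partial>lborel) \<le> internal_energy P \<rho>"
      unfolding internal_energy_def using v internal_density_nonneg[OF P(1)]
      by (intro nn_integral_mono ennreal_leI) (simp add: mult_left_le_one_le)
    then obtain b where b: "0 \<le> b" "(\<integral>\<^sup>+x. ennreal (v x * internal_density P (\<rho> x)) \<partial>lborel) = ennreal b"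
      using u by (cases "\<integral>\<^sup>+x. ennreal (v x * internal_density P (\<rho> x)) \<partial>lborel") (auto simp: top_unique)
    \<comment> \<open>The deposited mass \<theta> lies entirely on S, where the potential is at
      least \<Lambda> + \<epsilon>.\<close>
    have pl: "\<theta> * (\<Lambda> + \<epsilon>) \<le> p"
    proof -
      have "ennreal (\<theta> * (\<Lambda> + \<epsilon>)) = (\<integral>\<^sup>+x. ennreal (f x) * ennreal (\<Lambda> + \<epsilon>) \<partial>lborel)"
        using \<theta> a by (simp add: nn_integral_multc f1 ennreal_mult)
      also have "\<dots> \<le> (\<integral>\<^sup>+x. ennreal (f x) * potential \<rho> x \<partial>lborel)"
      proof (intro nn_integral_mono)
        fix x
        show "ennreal (f x) * ennreal (\<Lambda> + \<epsilon>) \<le> ennreal (f x) * potential \<rho> x"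
          by (cases "x \<in> S") (auto intro!: mult_left_mono SV simp: f_def \<sigma>0_def)
      qed
      also have "\<dots> = ennreal p" using f0 \<rho>(2) p by (simp add: pairing_eq_potential)
      finally show ?thesis using p by (simp add: ennreal_le_iff)
    qed
    obtain t0 where t0: "t0 > 0" "t0 \<le> 1" "\<And>t. 0 < t \<Longrightarrow> t < t0 \<Longrightarrow>
          energy P J \<rho> \<le> energy P J (\<lambda>x. (1 - t) * \<rho> x + t * \<sigma> x)"
      using min \<sigma>d \<sigma>nn unfolding segment_minimizer_def by blast
    \<comment> \<open>The balance per unit of t: b is the internal energy freed by removing v rho,
      \<theta> \<Lambda> bounds the cost of depositing it on S, p is the gravitational gain there
      and q the loss from the removal. The restriction t < a * sz keeps \<open>t * f x\<close> at
      most \<open>a\<close>, as \<open>slope\<close> demands.\<close>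
    have "b - \<theta> * \<Lambda> + p - q \<le> t * p" if t: "0 < t" "t < min t0 (a * sz)" for t
    proof -
      define \<kappa> where "\<kappa> x = (1 - t * v x) * \<rho> x + t * f x" for x
      have \<kappa>eq: "\<kappa> = (\<lambda>x. (1 - t) * \<rho> x + t * \<sigma> x)"
        by (auto simp: \<kappa>_def \<sigma>_def algebra_simps)
      have \<kappa>d: "\<kappa> \<in> densities" unfolding \<kappa>eq
        using t t0 by (intro densities_convex \<rho> \<sigma>d \<sigma>nn) auto
      have \<kappa>0: "0 \<le> \<kappa> x" for x unfolding \<kappa>eq using \<rho>(2) \<sigma>nn t t0 by simp
      have \<kappa>m[measurable]: "\<kappa> \<in> borel_measurable borel" unfolding \<kappa>_def[abs_def] by measurable
      have tv: "0 \<le> t * v x" "t * v x \<le> 1" for x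
        using mult_mono[of t 1 "v x" 1] t t0 v by auto
      have A: "internal_density P (\<kappa> x) + t * (v x * internal_density P (\<rho> x))
          \<le> internal_density P (\<rho> x) + t * \<Lambda> * f x" for x
      proof -
        define s where "s = (1 - t * v x) * \<rho> x"
        have "internal_density P s \<le> (1 - t * v x) * internal_density P (\<rho> x)"
          unfolding s_def by (intro internal_density_shrink P \<rho>(2) tv)
        moreover have "internal_density P (s + t * f x) \<le> internal_density P s + t * f x * \<Lambda>"
        proof (cases "x \<in> S")
          case True
          have s: "0 \<le> s" "s \<le> \<rho> x" using tv \<rho>(2) by (auto simp: s_def mult_left_le_one_le)
          have "t * f x \<le> (a * sz) * (1 / sz)"
            using t f0[of x] f\<sigma>[of x] \<sigma>0b[of x] sz a by (intro mult_mono) auto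
          then have "t * f x \<le> a" using sz by simp
          then show ?thesis using s Sa[OF True] t f0 by (intro slope) auto
        qed (simp add: f_def \<sigma>0_def)
        ultimately show ?thesis by (simp add: \<kappa>_def s_def algebra_simps)
      qed
      have "internal_energy P \<kappa> + ennreal t * ennreal b
          = (\<integral>\<^sup>+x. ennreal (internal_density P (\<kappa> x))
              + ennreal t * ennreal (v x * internal_density P (\<rho> x)) \<partial>lborel)"
        unfolding b(2)[symmetric] internal_energy_def by (simp add: nn_integral_add nn_integral_cmult)
      also have "\<dots> \<le> (\<integral>\<^sup>+x. ennreal (internal_density P (\<rho> x)) + ennreal (t * \<Lambda>) * ennreal (f x) \<partial>lborel)"
      proof (intro nn_integral_mono)
        fix x
        have nn: "0 \<le> internal_density P (\<kappa> x)" "0 \<le> v x * internal_density P (\<rho> x)"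
           "0 \<le> internal_density P (\<rho> x)" "0 \<le> t * \<Lambda>" "0 \<le> t"
          using v t a internal_density_nonneg[OF P(1)] by auto
        show "ennreal (internal_density P (\<kappa> x)) + ennreal t * ennreal (v x * internal_density P (\<rho> x))
            \<le> ennreal (internal_density P (\<rho> x)) + ennreal (t * \<Lambda>) * ennreal (f x)"
          using ennreal_leI[OF A[of x]] nn f0[of x]
          by (simp only: ennreal_mult ennreal_plus mult_nonneg_nonneg)
      qed
      also have "\<dots> = ennreal (u + t * \<Lambda> * \<theta>)"
        using u t a \<theta> by (simp add: nn_integral_add nn_integral_cmult f1
            internal_energy_def[symmetric] ennreal_mult)
      finally have U: "internal_energy P \<kappa> + ennreal t * ennreal b \<le> ennreal (u + t * \<Lambda> * \<theta>)" .
      then obtain u' where u': "0 \<le> u'" "internal_energy P \<kappa> = ennreal u'"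
        by (cases "internal_energy P \<kappa>") (auto simp: top_unique)
      have "ennreal (u' + t * b) \<le> ennreal (u + t * \<Lambda> * \<theta>)"
        using U u' b t by (simp add: ennreal_mult)
      then have uu: "u' + t * b \<le> u + t * \<Lambda> * \<theta>"
        using u a \<theta> t by (subst (asm) ennreal_le_iff) auto
      obtain g' where g': "0 \<le> g'" "gravity \<kappa> = ennreal g'"
        by (rule densities_gravity_finite[OF \<kappa>d \<kappa>0])
      have "gravity \<rho> + ennreal (2 * t) * pairing f \<rho>
        \<le> gravity \<kappa> + ennreal (2 * t) * pairing (\<lambda>x. v x * \<rho> x) \<rho> + ennreal (2 * t\<^sup>2) * pairing f \<rho>"
        unfolding \<kappa>_def[abs_def] using t t0 by (intro gravity_perturbation \<rho>(2) f0 v) auto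
      then have "ennreal (g + 2 * t * p) \<le> ennreal (g' + 2 * t * q + 2 * t\<^sup>2 * p)"
        using g g' p q t by (simp add: ennreal_mult)
      then have gg: "g + 2 * t * p \<le> g' + 2 * t * q + 2 * t\<^sup>2 * p"
        using g' p q t by (subst (asm) ennreal_le_iff) auto
      have "moment_of_inertia \<kappa> = \<infinity>"
        using t t0 \<sigma>nn by (intro moment_of_inertia_infinite_mono[OF D \<rho>(2) _ _ m2, of "1 - t"])
          (auto simp: \<kappa>eq)
      then have "energy P J \<kappa> = ereal (u' - g' / 2)" by (rule energy_cases_inertia(1)[OF u'(2,1) g'(2,1)])
      moreover have "energy P J \<rho> \<le> energy P J \<kappa>" unfolding \<kappa>eq using t by (intro t0) auto
      moreover have "energy P J \<rho> = ereal (u - g / 2)"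
        by (rule energy_cases_inertia(1)[OF u(2,1) g(2,1) moment_of_inertia_eq_top[OF m2]])
      ultimately have "u - g / 2 \<le> u' - g' / 2" by simp
      then have "t * (b - \<theta> * \<Lambda> + p - q) \<le> t * (t * p)"
        using uu gg by (simp add: algebra_simps power2_eq_square)
      then show ?thesis using t by simp
    qed
    then have "b - \<theta> * \<Lambda> + p - q \<le> 0"
      using nonpos_if_linear_bound[of "min t0 (a * sz)" "b - \<theta> * \<Lambda> + p - q" p] t0 a sz by auto
    then have "b + \<epsilon> * \<theta> \<le> q" using pl by (simp add: algebra_simps)
    then have "ennreal b + ennreal \<epsilon> * ennreal \<theta> \<le> ennreal q"
      using b a \<theta> by (simp add: ennreal_leI flip: ennreal_mult ennreal_plus)
    moreover have "ennreal q = (\<integral>\<^sup>+x. ennreal (v x * \<rho> x) * potential \<rho> x \<partial>lborel)"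
      unfolding q(2)[symmetric] using v \<rho>(2) by (intro pairing_eq_potential) auto
    ultimately show ?thesis using b \<theta> by simp
  qed
  then show ?thesis using a(3) by (intro exI[of _ \<epsilon>] conjI allI impI) blast+
qed

text \<open>Test the variational inequality with a truncation of \<open>(1 + |x|)\<^sup>2\<close>. Far out, where little
  mass is left, the near part of the potential is controlled by the internal energy thanks to (F3).\<close>

lemma second_moment_finite:
  assumes P: "pressure P" "small_density_condition P" and F3: "large_density_condition P"
    and \<rho>: "\<rho> \<in> densities" "\<And>x. 0 \<le> \<rho> x" and U: "internal_energy P \<rho> \<noteq> \<infinity>" and \<epsilon>: "\<epsilon> > 0"
    and var: "\<forall>v. v \<in> borel_measurable borel \<longrightarrow> (\<forall>x. 0 \<le> v x) \<longrightarrow> (\<forall>x. v x \<le> 1) \<longrightarrow>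
      (\<integral>\<^sup>+x. ennreal (v x * internal_density P (\<rho> x)) \<partial>lborel)
        + ennreal \<epsilon> * (\<integral>\<^sup>+x. ennreal (v x * \<rho> x) \<partial>lborel)
      \<le> (\<integral>\<^sup>+x. ennreal (v x * \<rho> x) * potential \<rho> x \<partial>lborel)"
  shows "(\<integral>\<^sup>+x. ennreal ((axis_dist x)\<^sup>2 * \<rho> x) \<partial>lborel) < \<infinity>"
proof -
  have D[measurable]: "\<rho> \<in> borel_measurable borel" and mass: "(\<integral>\<^sup>+x. ennreal (\<rho> x) \<partial>lborel) = 1"
    using densities_nonneg_iff[of \<rho>] \<rho> by auto
  note [measurable] = borel_measurable_internal_density[OF P]
  obtain u where u: "0 \<le> u" "internal_energy P \<rho> = ennreal u"
    using U by (cases "internal_energy P \<rho>") auto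
  obtain g where g: "0 \<le> g" "gravity \<rho> = ennreal g" by (rule densities_gravity_finite[OF \<rho>])
  \<comment> \<open>Matter beyond distance L then adds at most 1/L = \<epsilon>/4 to the
    potential.\<close>
  define L where "L = 4 / \<epsilon>"
  have L: "L > 0" using \<epsilon> by (simp add: L_def)
  \<comment> \<open>Comparability constant of the weight: if |x - y| < L then 1 + |y| is at most (1
    + L) (1 + |x|).\<close>
  define c where "c = (1 + L)\<^sup>2"
  have c: "c \<ge> 1" using L by (simp add: c_def power2_eq_square algebra_simps)
  obtain C :: real where C: "C > 0"
    "\<And>(\<rho> :: real^3 \<Rightarrow> real) L m x. \<lbrakk>\<rho> \<in> borel_measurable borel; \<And>y. 0 \<le> \<rho> y; 0 < m;
       (\<integral>\<^sup>+y\<in>ball x L. ennreal (\<rho> y) \<partial>lborel) \<le> ennreal m\<rbrakk> \<Longrightarrow>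
      dominated_potential \<rho> L x \<le> ennreal (C * m powr (2/3) * \<rho> x powr (1/3))"
    by (rule dominated_potential_bound) blast
  obtain \<delta> where \<delta>: "\<delta> > 0" "\<And>s. 0 \<le> s \<Longrightarrow> \<delta> * s powr (1/3) \<le> specific_energy P s + \<epsilon> / 4"
    using specific_energy_lower_bound[OF P F3, of "\<epsilon> / 4"] \<epsilon> by auto
  \<comment> \<open>Solves (1 + c) C m^(2/3) = \<delta>, so that 1 + c times the bound on the
    dominated potential is \<delta> rho^(1/3), which (F3) bounds by A(rho)/rho +
    \<epsilon>/4.\<close>
  define m where "m = (\<delta> / ((1 + c) * C)) powr (3/2)"
  have m: "m > 0" using \<delta> c C by (simp add: m_def)
  have "m powr (2/3) = \<delta> / ((1 + c) * C)" unfolding m_def powr_powr using \<delta> c C by simp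
  then have "(1 + c) * C * m powr (2/3) = \<delta>" using c C by simp
  then have Cm: "(1 + c) * (C * m powr (2/3)) = \<delta>" by (simp only: mult.assoc)
  obtain R where R: "R > 0" "(\<integral>\<^sup>+x\<in>- ball 0 R. ennreal (\<rho> x) \<partial>lborel) \<le> ennreal m"
    by (rule mass_outside_ball[OF D mass m])
  \<comment> \<open>Bounds 1 + c times the weight on the ball of radius R + L uniformly in the
    truncation; the interaction there is charged to the finite gravity.\<close>
  define K where "K = (1 + c) * (1 + (R + L))\<^sup>2"
  have K: "K \<ge> 0" using c by (simp add: K_def)
  define w where "w N x = min ((1 + norm x)\<^sup>2) (real (Suc N))" for N :: nat and x :: "real^3"
  have [measurable]: "w N \<in> borel_measurable borel" for N unfolding w_def[abs_def] by measurable
  have w0: "0 \<le> w N x" and wN: "w N x \<le> real (Suc N)" for N x by (auto simp: w_def)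
  have wc: "w N y \<le> c * w N x" if "norm (x - y) < L" for N x y
  proof -
    have "norm y \<le> norm x + norm (y - x)" by (rule norm_triangle_sub)
    then have "1 + norm y \<le> 1 + norm x + L" using that by (simp add: norm_minus_commute)
    also have "\<dots> \<le> (1 + L) * (1 + norm x)" using L by (simp add: algebra_simps)
    finally have "(1 + norm y)\<^sup>2 \<le> ((1 + L) * (1 + norm x))\<^sup>2" by (intro power_mono) auto
    then have 1: "(1 + norm y)\<^sup>2 \<le> c * (1 + norm x)\<^sup>2" by (simp add: c_def power_mult_distrib)
    have 2: "real (Suc N) \<le> c * real (Suc N)" using c by (simp add: mult_le_cancel_right1)
    show ?thesis
    proof (cases "(1 + norm x)\<^sup>2 \<le> real (Suc N)")
      case True
      then have "w N x = (1 + norm x)\<^sup>2" by (simp add: w_def)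
      moreover have "w N y \<le> (1 + norm y)\<^sup>2" by (simp add: w_def)
      ultimately show ?thesis using 1 by simp
    next
      case False
      then have "w N x = real (Suc N)" by (simp add: w_def)
      then show ?thesis using order_trans[OF wN[of N y] 2] by simp
    qed
  qed
  \<comment> \<open>The radius is R + L because for |x| at least R + L the ball of radius L about x
    misses the ball of radius R, so it contains at most mass m.\<close>
  have near: "ennreal (1 + c) * (ennreal (w N x * \<rho> x) * dominated_potential \<rho> L x)
      \<le> ennreal (w N x * internal_density P (\<rho> x)) + ennreal (\<epsilon> / 4) * ennreal (w N x * \<rho> x)
        + ennreal K * (potential \<rho> x * ennreal (\<rho> x))" for N x
  proof (cases "norm x < R + L")
    case True
    have "w N x \<le> (1 + norm x)\<^sup>2" by (simp add: w_def)
    also have "\<dots> \<le> (1 + (R + L))\<^sup>2" using True by (intro power_mono) auto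
    finally have "(1 + c) * w N x * \<rho> x \<le> K * \<rho> x"
      unfolding K_def using c \<rho>(2) by (intro mult_right_mono mult_left_mono) auto
    from mult_mono[OF ennreal_leI[OF this] dominated_potential_le[OF \<rho>(2)]]
    have "ennreal ((1 + c) * w N x * \<rho> x) * dominated_potential \<rho> L x \<le> ennreal (K * \<rho> x) * potential \<rho> x"
      by simp
    then have "ennreal (1 + c) * (ennreal (w N x * \<rho> x) * dominated_potential \<rho> L x)
       \<le> ennreal K * (potential \<rho> x * ennreal (\<rho> x))"
      using c w0[of N x] \<rho>(2)[of x] K by (simp add: ennreal_mult mult_ac)
    then show ?thesis by (simp add: add_increasing)
  next
    case False
    have "(\<integral>\<^sup>+y\<in>ball x L. ennreal (\<rho> y) \<partial>lborel) \<le> (\<integral>\<^sup>+y\<in>- ball 0 R. ennreal (\<rho> y) \<partial>lborel)"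
    proof (intro nn_integral_mono mult_left_mono)
      fix y
      have "y \<notin> ball 0 R" if "y \<in> ball x L"
        using norm_triangle_sub[of x y] False that by (simp add: dist_norm)
      then show "(indicator (ball x L) y :: ennreal) \<le> indicator (- ball 0 R) y"
        by (auto simp: indicator_def)
    qed simp
    also note R(2)
    finally have "dominated_potential \<rho> L x \<le> ennreal (C * m powr (2/3) * \<rho> x powr (1/3))"
      by (intro C(2) D \<rho>(2) m)
    then have "ennreal (1 + c) * (ennreal (w N x * \<rho> x) * dominated_potential \<rho> L x)
      \<le> ennreal (1 + c) * (ennreal (w N x * \<rho> x) * ennreal (C * m powr (2/3) * \<rho> x powr (1/3)))"
      by (intro mult_left_mono) auto
    also have "\<dots> = ennreal (w N x * \<rho> x * (\<delta> * \<rho> x powr (1/3)))"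
    proof -
      have "w N x * \<rho> x * (\<delta> * \<rho> x powr (1/3))
          = (1 + c) * (w N x * \<rho> x * (C * m powr (2/3) * \<rho> x powr (1/3)))"
        unfolding Cm[symmetric] by (simp only: mult_ac)
      moreover have "0 \<le> 1 + c" "0 \<le> w N x * \<rho> x" "0 \<le> C * m powr (2/3) * \<rho> x powr (1/3)"
        using c w0[of N x] \<rho>(2)[of x] C(1) by auto
      ultimately show ?thesis by (simp only: ennreal_mult mult_nonneg_nonneg)
    qed
    also have "\<dots> \<le> ennreal (w N x * \<rho> x * (specific_energy P (\<rho> x) + \<epsilon> / 4))"
      using w0 \<rho>(2) by (intro ennreal_leI mult_left_mono \<delta>) auto
    also have "w N x * \<rho> x * (specific_energy P (\<rho> x) + \<epsilon> / 4)
        = w N x * internal_density P (\<rho> x) + \<epsilon> / 4 * (w N x * \<rho> x)"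
      by (simp add: internal_density_eq algebra_simps)
    also have "ennreal \<dots> = ennreal (w N x * internal_density P (\<rho> x)) + ennreal (\<epsilon> / 4) * ennreal (w N x * \<rho> x)"
      using w0[of N x] \<rho>(2)[of x] \<epsilon> internal_density_nonneg[OF P(1), of "\<rho> x"]
      by (simp only: ennreal_plus ennreal_mult mult_nonneg_nonneg less_imp_le divide_nonneg_nonneg zero_le_numeral)
    finally show ?thesis by (rule order_trans) simp
  qed
  have bound: "(\<integral>\<^sup>+x. ennreal (w N x * \<rho> x) \<partial>lborel) \<le> ennreal (2 * K * g / \<epsilon>)" for N
  proof -
    let ?N = "real (Suc N)"
    have "(\<integral>\<^sup>+x. ennreal (w N x * \<rho> x) \<partial>lborel) \<le> (\<integral>\<^sup>+x. ennreal ?N * ennreal (\<rho> x) \<partial>lborel)"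
      using wN[of N] \<rho>(2) by (intro nn_integral_mono) (simp add: ennreal_leI mult_right_mono del: of_nat_Suc flip: ennreal_mult)
    also have "\<dots> = ennreal ?N" by (simp add: nn_integral_cmult mass)
    \<comment> \<open>Truncation makes X and, below, Z finite; only then can Z be cancelled and
      multiples of X be absorbed.\<close>
    finally obtain X where X: "0 \<le> X" "(\<integral>\<^sup>+x. ennreal (w N x * \<rho> x) \<partial>lborel) = ennreal X"
      by (cases "\<integral>\<^sup>+x. ennreal (w N x * \<rho> x) \<partial>lborel") (auto simp: top_unique)
    have "(\<integral>\<^sup>+x. ennreal (w N x * internal_density P (\<rho> x)) \<partial>lborel)
        \<le> (\<integral>\<^sup>+x. ennreal ?N * ennreal (internal_density P (\<rho> x)) \<partial>lborel)"
      using wN[of N] internal_density_nonneg[OF P(1)]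
      by (intro nn_integral_mono) (simp add: ennreal_leI mult_right_mono del: of_nat_Suc flip: ennreal_mult)
    also have "\<dots> = ennreal (?N * u)"
      using u by (simp add: nn_integral_cmult internal_energy_def[symmetric] ennreal_mult del: of_nat_Suc)
    finally obtain Z where Z: "0 \<le> Z" "(\<integral>\<^sup>+x. ennreal (w N x * internal_density P (\<rho> x)) \<partial>lborel) = ennreal Z"
      by (cases "\<integral>\<^sup>+x. ennreal (w N x * internal_density P (\<rho> x)) \<partial>lborel") (auto simp: top_unique)
    \<comment> \<open>Division by N + 1 brings the weight below 1, as the variational inequality
      requires; multiplying that inequality by N + 1 returns to the weight itself.\<close>
    define v where "v x = w N x / ?N" for x
    have [measurable]: "v \<in> borel_measurable borel" unfolding v_def[abs_def] by measurable
    have v: "0 \<le> v x" "v x \<le> 1" for x using w0 wN[of N x] by (auto simp: v_def divide_le_eq_1)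
    have scale: "ennreal (w N x * z) = ennreal ?N * ennreal (v x * z)" if "0 \<le> z" for x z
    proof -
      have "w N x * z = ?N * (v x * z)" by (simp add: v_def del: of_nat_Suc)
      then show ?thesis using that v[of x] by (simp only: ennreal_mult mult_nonneg_nonneg of_nat_0_le_iff)
    qed
    have "ennreal Z + ennreal \<epsilon> * ennreal X
      = ennreal ?N * ((\<integral>\<^sup>+x. ennreal (v x * internal_density P (\<rho> x)) \<partial>lborel)
        + ennreal \<epsilon> * (\<integral>\<^sup>+x. ennreal (v x * \<rho> x) \<partial>lborel))"
      unfolding X(2)[symmetric] Z(2)[symmetric]
    proof -
      have "(\<integral>\<^sup>+x. ennreal (w N x * internal_density P (\<rho> x)) \<partial>lborel)
          = ennreal ?N * (\<integral>\<^sup>+x. ennreal (v x * internal_density P (\<rho> x)) \<partial>lborel)"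
        using internal_density_nonneg[OF P(1)] by (simp add: scale nn_integral_cmult del: of_nat_Suc)
      moreover have "(\<integral>\<^sup>+x. ennreal (w N x * \<rho> x) \<partial>lborel)
          = ennreal ?N * (\<integral>\<^sup>+x. ennreal (v x * \<rho> x) \<partial>lborel)"
        using \<rho>(2) by (simp add: scale nn_integral_cmult del: of_nat_Suc)
      ultimately show "(\<integral>\<^sup>+x. ennreal (w N x * internal_density P (\<rho> x)) \<partial>lborel)
          + ennreal \<epsilon> * (\<integral>\<^sup>+x. ennreal (w N x * \<rho> x) \<partial>lborel)
        = ennreal ?N * ((\<integral>\<^sup>+x. ennreal (v x * internal_density P (\<rho> x)) \<partial>lborel)
          + ennreal \<epsilon> * (\<integral>\<^sup>+x. ennreal (v x * \<rho> x) \<partial>lborel))"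
        by (simp only: distrib_left mult.left_commute)
    qed
    also have "\<dots> \<le> ennreal ?N * (\<integral>\<^sup>+x. ennreal (v x * \<rho> x) * potential \<rho> x \<partial>lborel)"
      by (intro mult_left_mono var[rule_format] v) auto
    also have "\<dots> = (\<integral>\<^sup>+x. ennreal (w N x * \<rho> x) * potential \<rho> x \<partial>lborel)"
      using \<rho>(2) by (simp add: scale nn_integral_cmult mult.assoc del: of_nat_Suc)
    also have "\<dots> \<le> ennreal (1/L) * (\<integral>\<^sup>+x. ennreal (w N x * \<rho> x) \<partial>lborel)
      + ennreal (1 + c) * (\<integral>\<^sup>+x. ennreal (w N x * \<rho> x) * dominated_potential \<rho> L x \<partial>lborel)"
      using mass c L by (intro weighted_potential_bound \<rho>(2) w0 wc) auto
    also have "ennreal (1 + c) * (\<integral>\<^sup>+x. ennreal (w N x * \<rho> x) * dominated_potential \<rho> L x \<partial>lborel)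
      = (\<integral>\<^sup>+x. ennreal (1 + c) * (ennreal (w N x * \<rho> x) * dominated_potential \<rho> L x) \<partial>lborel)"
      by (rule nn_integral_cmult[symmetric]) measurable
    also have "\<dots> \<le> (\<integral>\<^sup>+x. ennreal (w N x * internal_density P (\<rho> x)) + ennreal (\<epsilon> / 4) * ennreal (w N x * \<rho> x)
        + ennreal K * (potential \<rho> x * ennreal (\<rho> x)) \<partial>lborel)"
      by (intro nn_integral_mono near)
    also have "\<dots> = ennreal Z + ennreal (\<epsilon> / 4) * ennreal X + ennreal K * ennreal g"
      using X Z g by (simp add: nn_integral_add nn_integral_cmult gravity_def[symmetric])
    finally have le: "ennreal Z + ennreal \<epsilon> * ennreal X
        \<le> ennreal (1 / L) * (\<integral>\<^sup>+x. ennreal (w N x * \<rho> x) \<partial>lborel)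
          + (ennreal Z + ennreal (\<epsilon> / 4) * ennreal X + ennreal K * ennreal g)"
      by this (rule add_left_mono)
    have "ennreal (Z + \<epsilon> * X) \<le> ennreal (1 / L * X + (Z + \<epsilon> / 4 * X + K * g))"
    proof -
      have "0 \<le> \<epsilon>" "0 \<le> \<epsilon> / 4" "0 \<le> 1 / L" using \<epsilon> L by auto
      then have "ennreal (Z + \<epsilon> * X) = ennreal Z + ennreal \<epsilon> * ennreal X"
        "ennreal (1 / L * X + (Z + \<epsilon> / 4 * X + K * g))
          = ennreal (1 / L) * ennreal X + (ennreal Z + ennreal (\<epsilon> / 4) * ennreal X + ennreal K * ennreal g)"
        using X(1) Z(1) g(1) K
        by (simp_all only: ennreal_plus ennreal_mult mult_nonneg_nonneg add_nonneg_nonneg)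
      then show ?thesis using le by (simp only: X(2))
    qed
    then have "Z + \<epsilon> * X \<le> 1 / L * X + (Z + \<epsilon> / 4 * X + K * g)"
      using X Z g K \<epsilon> L by (subst (asm) ennreal_le_iff) auto
    moreover have "1 / L * X = \<epsilon> * X / 4" "\<epsilon> / 4 * X = \<epsilon> * X / 4" by (simp_all add: L_def)
    \<comment> \<open>The far part and the remainder in the bound from (F3) each use up \<epsilon> X
      / 4 of the gain \<epsilon> X. What remains on the right does not depend on N.\<close>
    ultimately have "\<epsilon> * X / 2 \<le> K * g" by linarith
    moreover have "X * \<epsilon> = \<epsilon> * X" "2 * K * g = 2 * (K * g)" by simp_all
    ultimately have "X * \<epsilon> \<le> 2 * K * g" by linarith
    then have "X \<le> 2 * K * g / \<epsilon>" using \<epsilon> by (simp only: pos_le_divide_eq)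
    then show ?thesis using X by (simp add: ennreal_leI)
  qed
  have "(\<lambda>N. \<integral>\<^sup>+x. ennreal (w N x * \<rho> x) \<partial>lborel) \<longlonglongrightarrow> (\<integral>\<^sup>+x. ennreal ((1 + norm x)\<^sup>2 * \<rho> x) \<partial>lborel)"
  proof (rule nn_integral_LIMSEQ)
    show "incseq (\<lambda>N x. ennreal (w N x * \<rho> x))"
      using \<rho>(2) by (auto simp: incseq_def le_fun_def w_def intro!: ennreal_leI mult_right_mono)
    show "(\<lambda>N. ennreal (w N x * \<rho> x)) \<longlonglongrightarrow> ennreal ((1 + norm x)\<^sup>2 * \<rho> x)" for x
    proof (rule tendsto_eventually)
      obtain N0 where N0: "(1 + norm x)\<^sup>2 < real N0" using reals_Archimedean2 by blast
      show "\<forall>\<^sub>F N in sequentially. ennreal (w N x * \<rho> x) = ennreal ((1 + norm x)\<^sup>2 * \<rho> x)"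
        using N0 by (intro eventually_sequentiallyI[of N0]) (auto simp: w_def min_def)
    qed
  qed measurable
  then have le: "(\<integral>\<^sup>+x. ennreal ((1 + norm x)\<^sup>2 * \<rho> x) \<partial>lborel) \<le> ennreal (2 * K * g / \<epsilon>)"
    by (rule LIMSEQ_le_const2) (use bound in auto)
  have "(\<integral>\<^sup>+x. ennreal ((axis_dist x)\<^sup>2 * \<rho> x) \<partial>lborel)
      \<le> (\<integral>\<^sup>+x. ennreal ((1 + norm x)\<^sup>2 * \<rho> x) \<partial>lborel)"
  proof (intro nn_integral_mono ennreal_leI mult_right_mono \<rho>(2))
    fix x :: "real^3"
    have "(axis_dist x)\<^sup>2 \<le> (norm x)\<^sup>2"
      by (simp add: axis_dist_def norm_vec_def L2_set_def sum_3)
    also have "\<dots> \<le> (1 + norm x)\<^sup>2" by (intro power_mono) auto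
    finally show "(axis_dist x)\<^sup>2 \<le> (1 + norm x)\<^sup>2" .
  qed
  also note le
  also have "ennreal (2 * K * g / \<epsilon>) < \<infinity>" by simp
  finally show ?thesis .
qed

theorem proposition5p14:
  fixes P :: "real \<Rightarrow> real" and J :: real
    and Y :: "'v::real_vector topology" and j :: "(real^3 \<Rightarrow> real) \<Rightarrow> 'v"
    and T :: "(real^3 \<Rightarrow> real) topology"
  assumes F1: "pressure P"
    and F2: "small_density_condition P"
    and F3: "large_density_condition P"
    and J: "J > 0"
    and incl: "inclusion_into_tvs densities j Y"
    and T: "T = pullback_topology densities j Y"
  shows "\<not> (\<exists>\<rho>\<in>densities. local_minimizer T (energy P J) \<rho> \<and> energy P J \<rho> < \<infinity>)"
proof
  assume "\<exists>\<rho>\<in>densities. local_minimizer T (energy P J) \<rho> \<and> energy P J \<rho> < \<infinity>"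
  then obtain \<rho>' where \<rho>': "\<rho>' \<in> densities" "local_minimizer T (energy P J) \<rho>'" "energy P J \<rho>' < \<infinity>"
    by blast
  \<comment> \<open>Local minimality is known for \<open>\<rho>'\<close>, while the estimates are
    stated for densities that are nonnegative everywhere.\<close>
  define \<rho> where "\<rho> x = max 0 (\<rho>' x)" for x
  have \<rho>: "\<rho> \<in> densities" "AE x in lborel. \<rho>' x = \<rho> x"
    unfolding \<rho>_def[abs_def] using densities_positive_part[OF \<rho>'(1)] by auto
  have \<rho>0: "0 \<le> \<rho> x" for x by (simp add: \<rho>_def)
  have E: "energy P J \<rho>' = energy P J \<rho>"
    using \<rho> \<rho>' by (intro energy_cong_AE) (auto simp: densities_def)
  have min: "segment_minimizer (energy P J) \<rho>"
    unfolding segment_minimizer_def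
  proof (intro ballI impI)
    fix \<sigma> assume \<sigma>: "\<sigma> \<in> densities" "\<forall>x. 0 \<le> \<sigma> x"
    have "(\<lambda>x. (1 - t) * \<rho> x + t * \<sigma> x) \<in> densities" if "0 \<le> t" "t \<le> 1" for t
      using \<sigma> that by (intro densities_convex \<rho> \<rho>0) auto
    from local_minimizer_segment[OF incl \<rho>'(2)[unfolded T] \<rho>'(1) \<rho> \<sigma>(1) this]
    show "\<exists>t0>0. t0 \<le> 1 \<and> (\<forall>t. 0 < t \<longrightarrow> t < t0 \<longrightarrow>
        energy P J \<rho> \<le> energy P J (\<lambda>x. (1 - t) * \<rho> x + t * \<sigma> x))" unfolding E .
  qed
  have fin: "energy P J \<rho> < \<infinity>" using \<rho>' E by simp
  have m2: "(\<integral>\<^sup>+x. ennreal ((axis_dist x)\<^sup>2 * \<rho> x) \<partial>lborel) = \<infinity>"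
    by (rule segment_minimizer_second_moment_infinite[OF F1 F2 J \<rho>(1) \<rho>0 fin min])
  have U: "internal_energy P \<rho> \<noteq> \<infinity>"
    using fin internal_energy_infinite[of P \<rho> J] by auto
  show False
  proof (rule exE[OF segment_minimizer_variational_inequality[OF F1 F2 \<rho>(1) \<rho>0 fin min m2]], elim conjE)
    fix \<epsilon> :: real
    assume "\<epsilon> > 0" "\<forall>v. v \<in> borel_measurable borel \<longrightarrow> (\<forall>x. 0 \<le> v x) \<longrightarrow> (\<forall>x. v x \<le> 1) \<longrightarrow>
      (\<integral>\<^sup>+x. ennreal (v x * internal_density P (\<rho> x)) \<partial>lborel)
        + ennreal \<epsilon> * (\<integral>\<^sup>+x. ennreal (v x * \<rho> x) \<partial>lborel)
      \<le> (\<integral>\<^sup>+x. ennreal (v x * \<rho> x) * potential \<rho> x \<partial>lborel)"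
    from second_moment_finite[OF F1 F2 F3 \<rho>(1) \<rho>0 U this] show False using m2 by simp
  qed
qed

end
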